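(* A graph $G$ satisfies $G\in Forb\{K_{1,3},\overline{K_{1,3}}\}$ (that is, neither $K_{1,3}$ nor its complement $\overline{K_{1,3}}$ is isomorphic to an induced subgraph of $G$) if and only if $G$ or its complement $\overline G$ is one of the following: (a) a graph isomorphic to $A_6$; (b) a graph isomorphic to an induced subgraph of $P_9$; (c) a graph each of whose connected components is a cycle of length at least $4$, a path, or an isolated vertex.
   Context: Graphs are undirected, simple and loopless: a graph is a pair $(V,\mathcal E)$ with $\mathcal E\subseteq [V]^2$, the set of $2$-element subsets of $V$. No finiteness of $V$ is required; if $V$ is infinite, a connected component that is a path may be a finite, one-way infinite or two-way infinite path. The complement of $G=(V,\mathcal E)$ is $\overline G=(V,[V]^2\setminus\mathcal E)$. For a set $\mathcal F$ of graphs, $Forb\,\mathcal F$ is the class of graphs $G$ such that no member of $\mathcal F$ is isomorphic to an induced subgraph of $G$. $K_{1,3}$ (the claw) is the graph on $4$ vertices made of one vertex adjacent to three pairwise nonadjacent vertices. $A_6$ is the graph on $6$ vertices made of a triangle $K_3$ bounded by three triangles: vertices $a,b,c,a',b',c'$, where $a,b,c$ are pairwise adjacent, $a'$ is adjacent exactly to $b,c$, $b'$ exactly to $a,c$, and $c'$ exactly to $a,b$ (nine edges in all). $P_9$ is the Paley graph on $9$ vertices, isomorphic to the cartesian product $K_3\Box K_3$: its vertices are the pairs $(i,j)$ with $i,j\in\{0,1,2\}$, two distinct pairs being adjacent iff they agree in exactly one coordinate. *)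

theory Defs
  imports Main "HOL-Library.Ramsey"
begin

text \<open>A graph is a pair of a vertex set, possibly infinite, and an edge set consisting of
  2-element sets of vertices. \<open>[V]\<^bsup>2\<^esup>\<close> is the notation of theory Ramsey for the set of
  2-element subsets of \<open>V\<close>.\<close>

type_synonym 'a graph = "'a set \<times> 'a set set"

abbreviation verts :: "'a graph \<Rightarrow> 'a set" where
  "verts G \<equiv> fst G"

abbreviation edges :: "'a graph \<Rightarrow> 'a set set" where
  "edges G \<equiv> snd G"

definition is_graph :: "'a graph \<Rightarrow> bool" where
  "is_graph G \<longleftrightarrow> edges G \<subseteq> [verts G]\<^bsup>2\<^esup>"

definition complement :: "'a graph \<Rightarrow> 'a graph" where
  "complement G = (verts G, [verts G]\<^bsup>2\<^esup> - edges G)"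

definition induced :: "'a graph \<Rightarrow> 'a set \<Rightarrow> 'a graph" where
  "induced G X = (X, edges G \<inter> [X]\<^bsup>2\<^esup>)"

definition isomorphic :: "'a graph \<Rightarrow> 'b graph \<Rightarrow> bool" where
  "isomorphic G H \<longleftrightarrow>
    (\<exists>f. bij_betw f (verts G) (verts H) \<and>
         (\<forall>x\<in>verts G. \<forall>y\<in>verts G. {x, y} \<in> edges G \<longleftrightarrow> {f x, f y} \<in> edges H))"

definition isomorphic_to_induced :: "'a graph \<Rightarrow> 'b graph \<Rightarrow> bool" where
  "isomorphic_to_induced H G \<longleftrightarrow> (\<exists>X\<subseteq>verts G. isomorphic H (induced G X))"

definition Forb :: "'b graph set \<Rightarrow> 'a graph set" where
  "Forb \<F> = {G. is_graph G \<and> (\<forall>H\<in>\<F>. \<not> isomorphic_to_induced H G)}"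

definition K13 :: "nat graph" where
  "K13 = ({0, 1, 2, 3}, {{0, 1}, {0, 2}, {0, 3}})"

text \<open>The vertices \<open>a, b, c, a', b', c'\<close> of \<open>A\<^sub>6\<close> are encoded as \<open>0, 1, 2, 3, 4, 5\<close>.\<close>

definition A6 :: "nat graph" where
  "A6 = ({0, 1, 2, 3, 4, 5},
    {{0, 1}, {0, 2}, {1, 2},
     {3, 1}, {3, 2}, {4, 0}, {4, 2}, {5, 0}, {5, 1}})"

definition P9 :: "(nat \<times> nat) graph" where
  "P9 = ({..<3} \<times> {..<3},
    {{(i, j), (k, l)} | i j k l.
       i < 3 \<and> j < 3 \<and> k < 3 \<and> l < 3 \<and> (i = k \<and> j \<noteq> l \<or> i \<noteq> k \<and> j = l)})"

definition adjacent :: "'a graph \<Rightarrow> ('a \<times> 'a) set" where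
  "adjacent G = {(x, y). {x, y} \<in> edges G}"

definition components :: "'a graph \<Rightarrow> 'a graph set" where
  "components G =
    {induced G {w \<in> verts G. (v, w) \<in> (adjacent G)\<^sup>*} | v. v \<in> verts G}"

text \<open>For \<open>n \<ge> 3\<close> this is the cycle of length \<open>n\<close>.\<close>

definition cycle_graph :: "nat \<Rightarrow> nat graph" where
  "cycle_graph n = ({..<n}, {{i, Suc i mod n} | i. i < n})"

text \<open>The path with \<open>n\<close> vertices.\<close>

definition path_graph :: "nat \<Rightarrow> nat graph" where
  "path_graph n = ({..<n}, {{i, Suc i} | i. Suc i < n})"

definition one_way_infinite_path :: "nat graph" where
  "one_way_infinite_path = (UNIV, {{i, Suc i} | i. True})"

definition two_way_infinite_path :: "int graph" where
  "two_way_infinite_path = (UNIV, {{i, i + 1} | i. True})"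

definition is_path :: "'a graph \<Rightarrow> bool" where
  "is_path G \<longleftrightarrow>
    (\<exists>n\<ge>1. isomorphic G (path_graph n)) \<or>
    isomorphic G one_way_infinite_path \<or>
    isomorphic G two_way_infinite_path"

definition is_cycle_of_length :: "'a graph \<Rightarrow> nat \<Rightarrow> bool" where
  "is_cycle_of_length G n \<longleftrightarrow> n \<ge> 3 \<and> isomorphic G (cycle_graph n)"

definition is_isolated_vertex :: "'a graph \<Rightarrow> bool" where
  "is_isolated_vertex G \<longleftrightarrow> (\<exists>v. G = ({v}, {}))"

definition components_cycles_or_paths :: "'a graph \<Rightarrow> bool" where
  "components_cycles_or_paths G \<longleftrightarrow>
    (\<forall>C\<in>components G.
       (\<exists>n\<ge>4. is_cycle_of_length C n) \<or> is_path C \<or> is_isolated_vertex C)"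

definition in_list :: "'a graph \<Rightarrow> bool" where
  "in_list G \<longleftrightarrow>
    isomorphic G A6 \<or> isomorphic_to_induced G P9 \<or> components_cycles_or_paths G"

end

(* If G has no triangle, excluding the claw bounds its degrees by 2, so its components are paths and
   cycles; dually if the complement has no triangle. If G contains both a triangle and an independent
   set of size 3, then counting edges between them gives a triangle and an independent 3-set that
   share a vertex, and these span a bull (a triangle with pendant edges at two of its vertices).
   Only six adjacency patterns to the bull are possible for a further vertex, no pattern occurs twice,
   and two of them, which give A6 and its complement, admit no further vertex at all. The other four
   have determined mutual adjacencies, and embed G into P9. *)
theory Submission
  imports Defs
begin

section \<open>Connected components of maximum degree 2\<close>

text \<open>No induction on the number of vertices is available, since \<open>V\<close> may be
  infinite. Finiteness in the exceptional cases is an outcome: each row of adjacencies to the bull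
  belongs to at most one vertex. For the same reason a component is recognised as a path or cycle
  through an explicit numbering of its vertices rather than by a longest path. Complementation
  halves the work. The bull is self-complementary with the shared vertex fixed, and arguing about an
  arbitrary relation \<open>E\<close> allows the same lemmas to be applied to non-adjacency.
  Complementation permutes the six patterns: the two belonging to \<open>A6\<close> and its
  complement are exchanged, the other four are permuted among themselves, in accordance with the
  self-complementarity of \<open>P9\<close>.\<close>

definition arcs :: "('a \<Rightarrow> 'a \<Rightarrow> bool) \<Rightarrow> ('a \<times> 'a) set" where
  "arcs E = {(x, y). E x y}"

definition reach :: "('a \<Rightarrow> 'a \<Rightarrow> bool) \<Rightarrow> 'a \<Rightarrow> 'a set" where
  "reach E v = {w. (v, w) \<in> (arcs E)\<^sup>*}"

lemma reach_refl: "v \<in> reach E v"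
  by (simp add: reach_def)

lemma reach_step: "w \<in> reach E v \<Longrightarrow> E w z \<Longrightarrow> z \<in> reach E v"
  unfolding reach_def arcs_def by (auto intro: rtrancl_into_rtrancl)

lemma reach_least:
  assumes "v \<in> S" and "\<And>w z. w \<in> S \<Longrightarrow> E w z \<Longrightarrow> z \<in> S"
  shows "reach E v \<subseteq> S"
proof
  fix w assume "w \<in> reach E v"
  then have "(v, w) \<in> (arcs E)\<^sup>*" by (simp add: reach_def)
  then show "w \<in> S"
    by (induction rule: rtrancl_induct) (use assms in \<open>auto simp: arcs_def\<close>)
qed

definition max_degree_2 :: "('a \<Rightarrow> 'a \<Rightarrow> bool) \<Rightarrow> bool" where
  "max_degree_2 E \<longleftrightarrow> (\<forall>x a b c. E x a \<longrightarrow> E x b \<longrightarrow> E x c \<longrightarrow> a = b \<or> a = c \<or> b = c)"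

text \<open>A vertex without neighbours also counts as an end; it gives rise to the path with one
  vertex.\<close>

definition end_vertex :: "('a \<Rightarrow> 'a \<Rightarrow> bool) \<Rightarrow> 'a \<Rightarrow> bool" where
  "end_vertex E e \<longleftrightarrow> (\<forall>a b. E e a \<longrightarrow> E e b \<longrightarrow> a = b)"

text \<open>The distance from an end vertex is injective, as two vertices at distance \<open>k + 1\<close> and one at
  distance \<open>k - 1\<close> would all be neighbours of the vertex at distance \<open>k\<close>.\<close>

lemma path_coordinate:
  assumes sym: "\<And>x y. E x y \<Longrightarrow> E y x"
    and irrefl: "\<And>x. \<not> E x x"
    and deg: "max_degree_2 E"
    and e: "end_vertex E e"
  obtains d :: "'a \<Rightarrow> nat" where "d e = 0" "inj_on d (reach E e)"
    "\<And>x y. x \<in> reach E e \<Longrightarrow> y \<in> reach E e \<Longrightarrow> E x y \<longleftrightarrow> d x = Suc (d y) \<or> d y = Suc (d x)"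
    "\<And>x k. x \<in> reach E e \<Longrightarrow> k \<le> d x \<Longrightarrow> k \<in> d ` reach E e"
proof -
  define d where "d w = (LEAST n. (e, w) \<in> arcs E ^^ n)" for w
  have d_rel: "(e, w) \<in> arcs E ^^ d w" if "w \<in> reach E e" for w
  proof -
    from that have "\<exists>n. (e, w) \<in> arcs E ^^ n" by (simp add: reach_def rtrancl_power)
    then show ?thesis unfolding d_def by (rule LeastI_ex)
  qed
  have d_le: "d w \<le> n" if "(e, w) \<in> arcs E ^^ n" for w n
    unfolding d_def using that by (rule Least_le)
  have rel_reach: "w \<in> reach E e" if "(e, w) \<in> arcs E ^^ n" for w n
    using that by (auto simp: reach_def rtrancl_power)
  have d_e: "d e = 0" using d_le[of e 0] by simp
  have d0: "w = e" if "w \<in> reach E e" "d w = 0" for w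
    using d_rel[OF that(1)] that(2) by simp
  have d_step: "d y \<le> Suc (d x)" if "x \<in> reach E e" "E x y" for x y
    using d_le[of y "Suc (d x)"] d_rel[OF that(1)] that(2) by (auto simp: arcs_def)
  have pred: "\<exists>p \<in> reach E e. E p w \<and> d p = n" if "w \<in> reach E e" "d w = Suc n" for w n
  proof -
    from d_rel[OF that(1)] that(2) have "(e, w) \<in> arcs E ^^ Suc n" by metis
    then obtain p where p: "(e, p) \<in> arcs E ^^ n" "E p w" by (auto simp: arcs_def)
    have "d p \<le> n" using d_le p(1) .
    moreover have "Suc n \<le> Suc (d p)" using d_step[OF rel_reach[OF p(1)] p(2)] that(2) by simp
    ultimately show ?thesis using p rel_reach by auto
  qed
  have unique: "x = y" if "x \<in> reach E e" "y \<in> reach E e" "d x = n" "d y = n" for x y n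
    using that
  proof (induction n arbitrary: x y)
    case 0
    then show ?case using d0[of x] d0[of y] by simp
  next
    case (Suc n)
    from pred[OF Suc.prems(1,3)] obtain p where p: "p \<in> reach E e" "E p x" "d p = n" by blast
    from pred[OF Suc.prems(2,4)] obtain q where q: "q \<in> reach E e" "E q y" "d q = n" by blast
    have "q = p" using Suc.IH p q by blast
    then have py: "E p y" using q by simp
    show ?case
    proof (cases n)
      \<comment> \<open>At distance 0 there is no vertex one step nearer to \<open>e\<close>; here
        the assumption that \<open>e\<close> is an end replaces the degree bound.\<close>
      case 0
      then have "p = e" using d0 p by simp
      then show ?thesis using e p(2) py by (auto simp: end_vertex_def)
    next
      case (Suc m)
      from pred[OF p(1)] p(3) Suc obtain z where z: "E z p" "d z = m" by blast
      have "z \<noteq> x" "z \<noteq> y" using z Suc Suc.prems by auto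
      then show ?thesis using deg sym[OF z(1)] p(2) py unfolding max_degree_2_def by blast
    qed
  qed
  have inj: "inj_on d (reach E e)" using unique by (auto intro: inj_onI)
  have down: "k \<in> d ` reach E e" if "x \<in> reach E e" "k \<le> d x" for x k
    using that
  proof (induction "d x - k" arbitrary: x)
    case 0
    then have "k = d x" by simp
    then show ?case using 0 by blast
  next
    case (Suc m)
    then obtain n where n: "d x = Suc n" by (cases "d x") auto
    from pred[OF Suc.prems(1) n] obtain p where p: "p \<in> reach E e" "d p = n" by blast
    show ?case by (rule Suc.hyps(1)[of p]) (use p n Suc in auto)
  qed
  have edge: "E y x" if "x \<in> reach E e" "y \<in> reach E e" "d x = Suc (d y)" for x y
    using pred[OF that(1,3)] unique that by blast
  have iff: "E x y \<longleftrightarrow> d x = Suc (d y) \<or> d y = Suc (d x)" if "x \<in> reach E e" "y \<in> reach E e" for x y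
  proof
    assume "E x y"
    then have le: "d x \<le> Suc (d y)" "d y \<le> Suc (d x)" using d_step sym that by blast+
    have "d x \<noteq> d y"
      using unique[OF that] irrefl \<open>E x y\<close> by metis
    with le show "d x = Suc (d y) \<or> d y = Suc (d x)" by linarith
  next
    assume "d x = Suc (d y) \<or> d y = Suc (d x)"
    then show "E x y" using edge[OF that] edge[OF that(2,1)] sym[of y x] by blast
  qed
  show ?thesis by (rule that[OF d_e inj iff down])
qed

lemma reach_trans:
  assumes "w \<in> reach E v"
  shows "reach E w \<subseteq> reach E v"
  using assms by (auto simp: reach_def)

lemma reach_eq:
  assumes sym: "\<And>x y. E x y \<Longrightarrow> E y x" and w: "w \<in> reach E v"
  shows "reach E w = reach E v"
proof -
  have "sym (arcs E)" unfolding arcs_def by (rule symI) (simp add: sym)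
  then have "sym ((arcs E)\<^sup>*)" by (rule sym_rtrancl)
  then have "v \<in> reach E w" using w unfolding reach_def by (simp add: symD)
  then show ?thesis by (intro equalityI reach_trans w)
qed

lemma reach_mono: "(\<And>x y. E x y \<Longrightarrow> F x y) \<Longrightarrow> reach E v \<subseteq> reach F v"
  unfolding reach_def arcs_def using rtrancl_mono[of "{(x, y). E x y}" "{(x, y). F x y}"] by auto

text \<open>If the component has an end, the distance from it is the numbering. Otherwise every
  vertex has two neighbours; cutting one edge \<open>v u\<close> turns both \<open>v\<close> and
  \<open>u\<close> into ends. If \<open>u\<close> can still be reached from \<open>v\<close>, the
  rest is a finite path which the edge closes to a cycle; if not, the rest consists of two infinite
  rays which the edge joins to a two-way infinite path.\<close>

lemma component_cases:
  assumes sym: "\<And>x y. E x y \<Longrightarrow> E y x"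
    and irrefl: "\<And>x. \<not> E x x"
    and deg: "max_degree_2 E"
    and tri: "\<And>x y z. E x y \<Longrightarrow> E y z \<Longrightarrow> E z x \<Longrightarrow> False"
  obtains
    (path) d :: "'a \<Rightarrow> nat" where "inj_on d (reach E v)"
      "\<And>x y. x \<in> reach E v \<Longrightarrow> y \<in> reach E v \<Longrightarrow> E x y \<longleftrightarrow> d x = Suc (d y) \<or> d y = Suc (d x)"
      "\<And>x k. x \<in> reach E v \<Longrightarrow> k \<le> d x \<Longrightarrow> k \<in> d ` reach E v"
  | (two_way) d :: "'a \<Rightarrow> int" where "bij_betw d (reach E v) UNIV"
      "\<And>x y. x \<in> reach E v \<Longrightarrow> y \<in> reach E v \<Longrightarrow> E x y \<longleftrightarrow> d x = d y + 1 \<or> d y = d x + 1"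
  | (cycle) d :: "'a \<Rightarrow> nat" and n where "n \<ge> 4" "bij_betw d (reach E v) {..<n}"
      "\<And>x y. x \<in> reach E v \<Longrightarrow> y \<in> reach E v \<Longrightarrow>
        E x y \<longleftrightarrow> d x = Suc (d y) mod n \<or> d y = Suc (d x) mod n"
proof (cases "\<exists>e \<in> reach E v. end_vertex E e")
  case True
  then obtain e where e: "e \<in> reach E v" "end_vertex E e" by blast
  have eq: "reach E e = reach E v" using reach_eq[of E e v] sym e(1) by blast
  from path_coordinate[of E, OF sym irrefl deg e(2)] obtain d :: "'a \<Rightarrow> nat" where
    "inj_on d (reach E e)"
    "\<And>x y. x \<in> reach E e \<Longrightarrow> y \<in> reach E e \<Longrightarrow> E x y \<longleftrightarrow> d x = Suc (d y) \<or> d y = Suc (d x)"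
    "\<And>x k. x \<in> reach E e \<Longrightarrow> k \<le> d x \<Longrightarrow> k \<in> d ` reach E e" by metis
  then show ?thesis using path[of d] unfolding eq by blast
next
  case False
  then obtain u where vu: "E v u" using reach_refl[of v E] unfolding end_vertex_def by blast
  then have uv: "E u v" "u \<noteq> v" using sym irrefl by blast+
  \<comment> \<open>\<open>F\<close> is \<open>E\<close> without the edge between \<open>u\<close>
    and \<open>v\<close>; only these two vertices lose a neighbour.\<close>
  define F where "F x y \<longleftrightarrow> E x y \<and> {x, y} \<noteq> {u, v}" for x y
  have FE: "F x y \<Longrightarrow> E x y" for x y by (simp add: F_def)
  have EF: "E x y \<longleftrightarrow> F x y \<or> x = u \<and> y = v \<or> x = v \<and> y = u" for x y
    using vu uv by (auto simp: F_def doubleton_eq_iff)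
  have F_uv: "\<not> F u v" "\<not> F v u" by (auto simp: F_def)
  have symF: "F x y \<Longrightarrow> F y x" for x y
    using sym by (auto simp: F_def doubleton_eq_iff)
  have irreflF: "\<not> F x x" for x using irrefl FE by blast
  have degF: "max_degree_2 F" using deg FE unfolding max_degree_2_def by blast
  have endv: "end_vertex F v"
    using deg vu unfolding max_degree_2_def end_vertex_def F_def by blast
  have endu: "end_vertex F u"
    using deg uv unfolding max_degree_2_def end_vertex_def F_def by blast
  have two: "\<exists>a b. F x a \<and> F x b \<and> a \<noteq> b" if "x \<in> reach E v" "x \<noteq> u" "x \<noteq> v" for x
  proof -
    have "E x a \<longleftrightarrow> F x a" for a using that EF by blast
    moreover have "\<exists>a b. E x a \<and> E x b \<and> a \<noteq> b"
      using False that(1) unfolding end_vertex_def by blast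
    ultimately show ?thesis by simp
  qed
  have one: "\<exists>a. F x a" if "x = u \<or> x = v" for x
  proof -
    have "x \<in> reach E v" using that reach_refl[of v E] reach_step[of v E v u, OF reach_refl vu] by blast
    then obtain a b where ab: "E x a" "E x b" "a \<noteq> b"
      using False unfolding end_vertex_def by blast
    have "F x c" if "E x c" "c \<noteq> u" "c \<noteq> v" for c using that EF by blast
    moreover have "x \<noteq> a" "x \<noteq> b" using ab irrefl by auto
    ultimately show ?thesis using ab \<open>x = u \<or> x = v\<close> by auto
  qed
  \<comment> \<open>A ray cannot stop: two distinct neighbours have distinct coordinates, each
    differing by one from that of \<open>x\<close>, so one of them is the successor. At coordinate 0
    any neighbour is a successor.\<close>
  have unbounded: "\<exists>y \<in> reach F e. d y = Suc (d x)"
    if d: "inj_on d (reach F e)"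
        "\<And>x y. x \<in> reach F e \<Longrightarrow> y \<in> reach F e \<Longrightarrow> F x y \<longleftrightarrow> d x = Suc (d y) \<or> d y = Suc (d x)"
      and x: "x \<in> reach F e" and two_e: "d x = 0 \<Longrightarrow> \<exists>a. F x a" 
      and two_x: "d x \<noteq> 0 \<Longrightarrow> \<exists>a b. F x a \<and> F x b \<and> a \<noteq> b" for d :: "'a \<Rightarrow> nat" and x e
  proof (cases "d x = 0")
    case True
    then obtain a where "F x a" using two_e by blast
    then show ?thesis using d(2)[OF x] reach_step[OF x] True by fastforce
  next
    case False
    then obtain a b where ab: "F x a" "F x b" "a \<noteq> b" using two_x by blast
    then have in_reach: "a \<in> reach F e" "b \<in> reach F e" using reach_step[OF x] by blast+
    then have "d a \<noteq> d b" using d(1) ab(3) by (auto dest: inj_onD)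
    then show ?thesis using d(2)[OF x in_reach(1)] d(2)[OF x in_reach(2)] ab in_reach by force
  qed
  from path_coordinate[of F, OF symF irreflF degF endv] obtain d :: "'a \<Rightarrow> nat" where
    d: "d v = 0" "inj_on d (reach F v)"
    "\<And>x y. x \<in> reach F v \<Longrightarrow> y \<in> reach F v \<Longrightarrow> F x y \<longleftrightarrow> d x = Suc (d y) \<or> d y = Suc (d x)"
    "\<And>x k. x \<in> reach F v \<Longrightarrow> k \<le> d x \<Longrightarrow> k \<in> d ` reach F v" by metis
  have d_eq: "d x = d y \<longleftrightarrow> x = y" if "x \<in> reach F v" "y \<in> reach F v" for x y
    using d(2) that by (auto dest: inj_onD)
  have sub: "reach F v \<subseteq> reach E v" using reach_mono[of F E] FE by blast
  show ?thesis
  proof (cases "u \<in> reach F v")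
    case True
    have eq: "reach F v = reach E v"
    proof
      show "reach E v \<subseteq> reach F v"
        by (rule reach_least) (use reach_refl[of v F] True reach_step[of _ F v] in \<open>auto simp: EF\<close>)
    qed (fact sub)
    define n where "n = Suc (d u)"
    have du0: "d u \<noteq> 0" using d_eq[OF True reach_refl] d(1) uv by auto
    \<comment> \<open>\<open>u\<close> is the last vertex: anything farther away would give it a
      second \<open>F\<close>-neighbour besides the one at \<open>d u - 1\<close>.\<close>
    have du: "d x \<le> d u" if "x \<in> reach F v" for x
    proof (rule ccontr)
      assume "\<not> d x \<le> d u"
      then have "Suc (d u) \<in> d ` reach F v" using d(4)[OF that] by simp
      then obtain a where a: "a \<in> reach F v" "d a = Suc (d u)" by force
      have "d u - 1 \<in> d ` reach F v" using d(4)[OF True] by simp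
      then obtain b where b: "b \<in> reach F v" "d b = d u - 1" by force
      have "F u a" "F u b" "a \<noteq> b" using d(3)[OF True] a b du0 by auto
      then show False using endu unfolding end_vertex_def by blast
    qed
    have img: "d ` reach E v = {..<n}"
      unfolding eq[symmetric] n_def using du d(4)[OF True] by (auto simp: less_Suc_eq_le)
    \<comment> \<open>Distance 1 would be the edge that was cut, and distance 2 would close a
      triangle with it, so the cycle has length \<open>d u + 1\<close> \<ge> 4.\<close>
    have "d u \<noteq> 1" using d(3)[OF True reach_refl] d(1) F_uv by simp
    have "d u \<noteq> 2"
    proof
      assume "d u = 2"
      then obtain a where a: "a \<in> reach F v" "d a = 1" using d(4)[OF True, of 1] by force
      then have "F u a" "F a v"
        using d(3)[OF True a(1)] d(3)[OF a(1) reach_refl] \<open>d u = 2\<close> d(1) by simp_all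
      then show False using tri vu FE by blast
    qed
    then have n4: "n \<ge> 4" using \<open>d u \<noteq> 1\<close> du0 by (simp add: n_def)
    show ?thesis
    proof (rule cycle[of n d])
      show "bij_betw d (reach E v) {..<n}" using d(2) img eq by (simp add: bij_betw_def)
      fix x y assume "x \<in> reach E v" "y \<in> reach E v"
      then have xy: "x \<in> reach F v" "y \<in> reach F v" by (simp_all add: eq)
      have mod: "Suc k mod n = (if k = d u then 0 else Suc k)" if "k \<le> d u" for k
        using that by (auto simp: n_def)
      have "x = u \<longleftrightarrow> d x = d u" "y = u \<longleftrightarrow> d y = d u" "x = v \<longleftrightarrow> d x = 0" "y = v \<longleftrightarrow> d y = 0"
        using d_eq[OF xy(1) True] d_eq[OF xy(2) True] d_eq[OF xy(1) reach_refl]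
          d_eq[OF xy(2) reach_refl] d(1) by auto
      then show "E x y \<longleftrightarrow> d x = Suc (d y) mod n \<or> d y = Suc (d x) mod n"
        unfolding EF d(3)[OF xy] mod[OF du[OF xy(1)]] mod[OF du[OF xy(2)]]
        using du[OF xy(1)] du[OF xy(2)] du0 by auto
    qed (fact n4)
  next
    case False
    have disj: "reach F v \<inter> reach F u = {}"
    proof (rule ccontr)
      assume "reach F v \<inter> reach F u \<noteq> {}"
      then obtain z where "z \<in> reach F v" "z \<in> reach F u" by blast
      then have "reach F v = reach F u"
        using reach_eq[of F z v] reach_eq[of F z u] symF by blast
      then show False using False reach_refl[of u F] by blast
    qed
    from path_coordinate[of F, OF symF irreflF degF endu] obtain c :: "'a \<Rightarrow> nat" where
      c: "c u = 0" "inj_on c (reach F u)"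
      "\<And>x y. x \<in> reach F u \<Longrightarrow> y \<in> reach F u \<Longrightarrow> F x y \<longleftrightarrow> c x = Suc (c y) \<or> c y = Suc (c x)"
      "\<And>x k. x \<in> reach F u \<Longrightarrow> k \<le> c x \<Longrightarrow> k \<in> c ` reach F u" by metis
    have c_eq: "c x = c y \<longleftrightarrow> x = y" if "x \<in> reach F u" "y \<in> reach F u" for x y
      using c(2) that by (auto dest: inj_onD)
    have subu: "reach F u \<subseteq> reach E v"
    proof (rule reach_least)
      show "u \<in> reach E v" using reach_step[of v E v u, OF reach_refl vu] .
      show "z \<in> reach E v" if "w \<in> reach E v" "F w z" for w z
        using reach_step[of w E v z, OF that(1) FE[OF that(2)]] .
    qed
    have un: "reach E v = reach F v \<union> reach F u"
    proof
      show "reach E v \<subseteq> reach F v \<union> reach F u"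
        using reach_refl[of v F] reach_refl[of u F] reach_step[of _ F v] reach_step[of _ F u]
        by (intro reach_least) (auto simp: EF)
    qed (use sub subu in blast)
    have surj_d: "k \<in> d ` reach F v" for k
    proof (induction k)
      case 0
      then show ?case using d(1) reach_refl[of v F] by force
    next
      case (Suc k)
      then obtain x where x: "x \<in> reach F v" "d x = k" by blast
      have "\<exists>y \<in> reach F v. d y = Suc (d x)"
      proof (rule unbounded[OF d(2,3) x(1)])
        show "\<exists>a. F x a" if "d x = 0"
          using one[of x] d_eq[OF x(1) reach_refl] that d(1) by simp
        show "\<exists>a b. F x a \<and> F x b \<and> a \<noteq> b" if "d x \<noteq> 0"
          by (rule two) (use x(1) sub that d(1) False in auto)
      qed
      then show ?case using x(2) by force
    qed
    have surj_c: "k \<in> c ` reach F u" for k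
    proof (induction k)
      case 0
      then show ?case using c(1) reach_refl[of u F] by force
    next
      case (Suc k)
      then obtain x where x: "x \<in> reach F u" "c x = k" by blast
      have "x \<noteq> v" using x(1) disj reach_refl[of v F] by blast
      have "\<exists>y \<in> reach F u. c y = Suc (c x)"
      proof (rule unbounded[OF c(2,3) x(1)])
        show "\<exists>a. F x a" if "c x = 0"
          using one[of x] c_eq[OF x(1) reach_refl] that c(1) by simp
        show "\<exists>a b. F x a \<and> F x b \<and> a \<noteq> b" if "c x \<noteq> 0"
          by (rule two) (use x(1) subu that c(1) \<open>x \<noteq> v\<close> in auto)
      qed
      then show ?case using x(2) by force
    qed
    \<comment> \<open>The shift by \<open>- 1\<close> puts \<open>u\<close> at -1 next to
      \<open>v\<close> at 0, so that the cut edge becomes a consecutive pair.\<close>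
    define g where "g x = (if x \<in> reach F v then int (d x) else - 1 - int (c x))" for x
    have gv: "x \<in> reach F v \<Longrightarrow> g x = int (d x)" for x by (simp add: g_def)
    have gu: "x \<in> reach F u \<Longrightarrow> g x = - 1 - int (c x)" for x using disj by (auto simp: g_def)
    have no_cross: "\<not> F x y" if "x \<in> reach F v" "y \<in> reach F u" for x y
      using reach_step[of x F v y] that disj by blast
    show ?thesis
    proof (rule two_way[of g])
      have "inj_on g (reach E v)"
        unfolding un by (intro inj_onI) (auto simp: gv gu d_eq c_eq)
      moreover have "k \<in> g ` reach E v" for k
      proof (cases "k \<ge> 0")
        case True
        then obtain x where "x \<in> reach F v" "d x = nat k" using surj_d[of "nat k"] by (metis imageE)
        then show ?thesis using True gv un by (intro image_eqI[of _ _ x]) auto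
      next
        case False
        then obtain x where "x \<in> reach F u" "c x = nat (- 1 - k)"
          using surj_c[of "nat (- 1 - k)"] by (metis imageE)
        then show ?thesis using False gu un by (intro image_eqI[of _ _ x]) auto
      qed
      ultimately show "bij_betw g (reach E v) UNIV" unfolding bij_betw_def by blast
    next
      have cross: "E x y \<longleftrightarrow> g x = g y + 1 \<or> g y = g x + 1"
        if "x \<in> reach F v" "y \<in> reach F u" for x y
      proof -
        have "E x y \<longleftrightarrow> x = v \<and> y = u" 
          using EF no_cross[OF that] that disj reach_refl[of v F] by blast
        also have "\<dots> \<longleftrightarrow> d x = 0 \<and> c y = 0"
          using d_eq[OF that(1) reach_refl] c_eq[OF that(2) reach_refl] d(1) c(1) by auto
        finally show ?thesis using gv gu that by auto
      qed
      fix x y assume "x \<in> reach E v" "y \<in> reach E v"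
      then consider "x \<in> reach F v" "y \<in> reach F v" | "x \<in> reach F v" "y \<in> reach F u"
        | "x \<in> reach F u" "y \<in> reach F v" | "x \<in> reach F u" "y \<in> reach F u" using un by blast
      then show "E x y \<longleftrightarrow> g x = g y + 1 \<or> g y = g x + 1"
      proof cases
        case 1
        then have "E x y \<longleftrightarrow> F x y" using False EF by blast
        then show ?thesis using d(3) 1 gv by auto
      next
        case 2
        then show ?thesis using cross by blast
      next
        case 3
        then show ?thesis using cross[of y x] sym by blast
      next
        case 4
        then have "E x y \<longleftrightarrow> F x y" using disj EF reach_refl[of v F] by blast
        then show ?thesis using c(3) 4 gu by auto
      qed
    qed
  qed
qed

section \<open>Graphs with a triangle and an independent 3-set\<close>

lemma P9_edge_iff:
  "{p, q} \<in> edges P9 \<longleftrightarrow> fst p < 3 \<and> snd p < 3 \<and> fst q < 3 \<and> snd q < 3 \<and>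
    (fst p = fst q) \<noteq> (snd p = snd q)"
  by (cases p; cases q) (auto simp: P9_def doubleton_eq_iff)

text \<open>The complement of the claw is a triangle with an isolated vertex, hence the last axiom:
  a vertex off a triangle has a neighbour on it. The set \<open>V\<close> is a parameter because
  isolated vertices matter there and because non-adjacency must be taken relative to it.\<close>

locale claw_coclaw_free =
  fixes V :: "'a set" and E :: "'a \<Rightarrow> 'a \<Rightarrow> bool"
  assumes sym: "E x y \<Longrightarrow> E y x"
    and irrefl: "\<not> E x x"
    and vertex: "E x y \<Longrightarrow> x \<in> V"
    and claw: "E x a \<Longrightarrow> E x b \<Longrightarrow> E x c \<Longrightarrow> a \<noteq> b \<Longrightarrow> a \<noteq> c \<Longrightarrow> b \<noteq> c \<Longrightarrow>
      E a b \<or> E a c \<or> E b c"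
    and coclaw: "E a b \<Longrightarrow> E a c \<Longrightarrow> E b c \<Longrightarrow> x \<in> V \<Longrightarrow> x \<noteq> a \<Longrightarrow> x \<noteq> b \<Longrightarrow> x \<noteq> c \<Longrightarrow>
      E x a \<or> E x b \<or> E x c"
begin

definition co :: "'a \<Rightarrow> 'a \<Rightarrow> bool" where
  "co x y \<longleftrightarrow> x \<in> V \<and> y \<in> V \<and> x \<noteq> y \<and> \<not> E x y"

lemma vertices: "E x y \<Longrightarrow> x \<in> V \<and> y \<in> V"
  using vertex sym by blast

text \<open>Each of the two axioms for \<open>co\<close> is the contrapositive of the other one for
  \<open>E\<close>, so everything proved in this locale also holds for the complement.\<close>

lemma dual: "claw_coclaw_free V co"
proof
  show "co x y \<Longrightarrow> co y x" for x y using sym by (auto simp: co_def)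
  show "co a b \<or> co a c \<or> co b c"
    if "co x a" "co x b" "co x c" "a \<noteq> b" "a \<noteq> c" "b \<noteq> c" for x a b c
    using that coclaw[of a b c x] by (auto simp: co_def)
  show "co x a \<or> co x b \<or> co x c"
    if "co a b" "co a c" "co b c" "x \<in> V" "x \<noteq> a" "x \<noteq> b" "x \<noteq> c" for x a b c
    using that claw[of x a b c] by (auto simp: co_def)
qed (auto simp: co_def)

end

text \<open>The triangle is \<open>x, t1, t2\<close> and the independent set is
  \<open>x, s1, s2\<close>; the pendant edges match equal indices.\<close>

locale bull = claw_coclaw_free +
  fixes x t1 t2 s1 s2 :: 'a
  assumes bull: "E x t1" "E x t2" "E t1 t2" "E t1 s1" "E t2 s2"
    "\<not> E x s1" "\<not> E x s2" "\<not> E s1 s2" "\<not> E t1 s2" "\<not> E t2 s1"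
begin

abbreviation B :: "'a set" where
  "B \<equiv> {x, t1, t2, s1, s2}"

lemma bull_sym: "E t1 x" "E t2 x" "E t2 t1" "E s1 t1" "E s2 t2"
    "\<not> E s1 x" "\<not> E s2 x" "\<not> E s2 s1" "\<not> E s2 t1" "\<not> E s1 t2"
  using bull sym by blast+

lemma B_subset: "B \<subseteq> V"
  using bull vertices by blast

lemma B_distinct: "x \<noteq> t1" "x \<noteq> t2" "x \<noteq> s1" "x \<noteq> s2" "t1 \<noteq> t2" "t1 \<noteq> s1" "t1 \<noteq> s2" "t2 \<noteq> s1"
    "t2 \<noteq> s2" "s1 \<noteq> s2"
  using bull bull_sym irrefl by blast+

lemmas B_distinct_sym = B_distinct B_distinct[symmetric]

definition nbrs :: "'a \<Rightarrow> bool \<times> bool \<times> bool \<times> bool \<times> bool" where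
  "nbrs v = (E v x, E v t1, E v t2, E v s1, E v s2)"

text \<open>Identify \<open>x, t1, t2, s1, s2\<close> with the points \<open>(0, 0), (0, 1), (0, 2), (1, 1), (2, 2)\<close> of \<open>P\<^sub>9\<close>. The
  first four rows are those of the other points \<open>(1, 2), (2, 1), (2, 0), (1, 0)\<close>; a vertex with the
  fifth row completes the bull to \<open>A\<^sub>6\<close>, one with the last row to the complement of \<open>A\<^sub>6\<close>.\<close>

lemma outside:
  assumes "v \<in> V" "v \<notin> B"
  shows "nbrs v \<in> {(False, False, True, True, True), (False, True, False, True, True),
      (True, False, False, False, True), (True, False, False, True, False),
      (False, True, True, True, True), (True, False, False, False, False)}"
proof -
  have in_V: "s1 \<in> V" "s2 \<in> V" using B_subset by auto
  have sv: "E x v = E v x" "E t1 v = E v t1" "E t2 v = E v t2" "E s1 v = E v s1" "E s2 v = E v s2"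
    using sym by blast+
  have ne: "v \<noteq> x" "v \<noteq> t1" "v \<noteq> t2" "v \<noteq> s1" "v \<noteq> s2" using assms(2) by auto
  note facts = bull bull_sym B_distinct_sym irrefl in_V sv ne ne[symmetric] assms(1)
  \<comment> \<open>Each of the eight constraints excludes a claw or its complement on
    \<open>v\<close> and three vertices of the bull; together they leave only the six listed
    rows.\<close>
  have "E v x \<or> E v t1 \<or> E v t2"
    using coclaw[of x t1 t2 v] by (simp add: facts)
  moreover have "E v t2 \<longrightarrow> E v x \<or> E v s2"
    using claw[of t2 x s2 v] by (auto simp: facts)
  moreover have "E v t2 \<and> E v s2 \<longrightarrow> E v s1"
    using coclaw[of t2 s2 v s1] by (auto simp: facts)
  moreover have "E v t1 \<longrightarrow> E v t2 \<or> E v s1"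
    using claw[of t1 t2 s1 v] by (auto simp: facts)
  moreover have "\<not> (E v x \<and> E v s1 \<and> E v s2)"
    using claw[of v x s1 s2] by (auto simp: facts)
  moreover have "E v t1 \<and> E v s1 \<longrightarrow> E v s2"
    using coclaw[of t1 s1 v s2] by (auto simp: facts)
  moreover have "E v x \<and> E v t2 \<longrightarrow> E v s1"
    using coclaw[of x t2 v s1] by (auto simp: facts)
  moreover have "E v t2 \<longrightarrow> E v t1 \<or> E v s2"
    using claw[of t2 t1 s2 v] by (auto simp: facts)
  ultimately show ?thesis unfolding nbrs_def
    by (cases "E v x"; cases "E v t1"; cases "E v t2"; cases "E v s1"; cases "E v s2") simp_all
qed

text \<open>Each line excludes one claw or complement of a claw on \<open>v\<close>,
  \<open>w\<close> and two vertices of the bull. For two vertices with the same row, whichever of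
  the six it is, one line demands the edge \<open>v w\<close> and another forbids it; for distinct
  rows the lines settle whether it is present. The last three are not symmetric in \<open>v\<close>
  and \<open>w\<close>.\<close>

lemma outside_pair:
  assumes "v \<in> V" "v \<notin> B" "w \<in> V" "w \<notin> B" "v \<noteq> w"
  shows "\<not> (E v x \<and> E w x \<and> \<not> E v t1 \<and> \<not> E w t1 \<and> \<not> E v w)"
    "\<not> (E v s1 \<and> E w s1 \<and> \<not> E v t1 \<and> \<not> E w t1 \<and> \<not> E v w)"
    "\<not> (E v s2 \<and> E w s2 \<and> \<not> E v t2 \<and> \<not> E w t2 \<and> \<not> E v w)"
    "\<not> (E v t1 \<and> E w t1 \<and> \<not> E v x \<and> \<not> E w x \<and> \<not> E v w)"
    "\<not> (E v t2 \<and> E w t2 \<and> \<not> E v x \<and> \<not> E w x \<and> \<not> E v w)"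
    "\<not> (E v x \<and> E w x \<and> \<not> E v s1 \<and> \<not> E w s1 \<and> E v w)"
    "\<not> (E v x \<and> E w x \<and> \<not> E v s2 \<and> \<not> E w s2 \<and> E v w)"
    "\<not> (E v s1 \<and> E w s1 \<and> \<not> E v x \<and> \<not> E w x \<and> E v w)"
    "\<not> (E v s1 \<and> E w s1 \<and> \<not> E v t2 \<and> \<not> E w t2 \<and> E v w)"
    "\<not> (E v s2 \<and> E w s2 \<and> \<not> E v t1 \<and> \<not> E w t1 \<and> E v w)"
    "\<not> (E v t1 \<and> E v s2 \<and> \<not> E w t1 \<and> \<not> E w s2 \<and> E v w)"
    "\<not> (E v t2 \<and> E v s1 \<and> \<not> E w t2 \<and> \<not> E w s1 \<and> E v w)"
    "\<not> (E v t1 \<and> E v t2 \<and> \<not> E w t1 \<and> \<not> E w t2 \<and> \<not> E v w)"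
proof -
  have in_V: "x \<in> V" "t1 \<in> V" "t2 \<in> V" "s1 \<in> V" "s2 \<in> V" using B_subset by auto
  have sv: "E x v = E v x" "E t1 v = E v t1" "E t2 v = E v t2" "E s1 v = E v s1" "E s2 v = E v s2"
    "E x w = E w x" "E t1 w = E w t1" "E t2 w = E w t2" "E s1 w = E w s1" "E s2 w = E w s2"
    "E w v = E v w"
    using sym by blast+
  have ne: "v \<noteq> x" "v \<noteq> t1" "v \<noteq> t2" "v \<noteq> s1" "v \<noteq> s2" "w \<noteq> x" "w \<noteq> t1" "w \<noteq> t2" "w \<noteq> s1" "w \<noteq> s2"
    using assms(2,4) by auto
  note facts = bull bull_sym B_distinct_sym irrefl in_V sv ne ne[symmetric] assms(1,3,5)
  show "\<not> (E v x \<and> E w x \<and> \<not> E v t1 \<and> \<not> E w t1 \<and> \<not> E v w)"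
    using claw[of x t1 v w] by (auto simp: facts)
  show "\<not> (E v s1 \<and> E w s1 \<and> \<not> E v t1 \<and> \<not> E w t1 \<and> \<not> E v w)"
    using claw[of s1 t1 v w] by (auto simp: facts)
  show "\<not> (E v s2 \<and> E w s2 \<and> \<not> E v t2 \<and> \<not> E w t2 \<and> \<not> E v w)"
    using claw[of s2 t2 v w] by (auto simp: facts)
  show "\<not> (E v t1 \<and> E w t1 \<and> \<not> E v x \<and> \<not> E w x \<and> \<not> E v w)"
    using claw[of t1 x v w] by (auto simp: facts)
  show "\<not> (E v t2 \<and> E w t2 \<and> \<not> E v x \<and> \<not> E w x \<and> \<not> E v w)"
    using claw[of t2 x v w] by (auto simp: facts)
  show "\<not> (E v x \<and> E w x \<and> \<not> E v s1 \<and> \<not> E w s1 \<and> E v w)"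
    using coclaw[of x v w s1] by (auto simp: facts)
  show "\<not> (E v x \<and> E w x \<and> \<not> E v s2 \<and> \<not> E w s2 \<and> E v w)"
    using coclaw[of x v w s2] by (auto simp: facts)
  show "\<not> (E v s1 \<and> E w s1 \<and> \<not> E v x \<and> \<not> E w x \<and> E v w)"
    using coclaw[of s1 v w x] by (auto simp: facts)
  show "\<not> (E v s1 \<and> E w s1 \<and> \<not> E v t2 \<and> \<not> E w t2 \<and> E v w)"
    using coclaw[of s1 v w t2] by (auto simp: facts)
  show "\<not> (E v s2 \<and> E w s2 \<and> \<not> E v t1 \<and> \<not> E w t1 \<and> E v w)"
    using coclaw[of s2 v w t1] by (auto simp: facts)
  show "\<not> (E v t1 \<and> E v s2 \<and> \<not> E w t1 \<and> \<not> E w s2 \<and> E v w)"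
    using claw[of v t1 s2 w] by (auto simp: facts)
  show "\<not> (E v t2 \<and> E v s1 \<and> \<not> E w t2 \<and> \<not> E w s1 \<and> E v w)"
    using claw[of v t2 s1 w] by (auto simp: facts)
  show "\<not> (E v t1 \<and> E v t2 \<and> \<not> E w t1 \<and> \<not> E w t2 \<and> \<not> E v w)"
    using coclaw[of t1 t2 v w] by (auto simp: facts)
qed

lemma A6_case:
  assumes u: "u \<in> V" "nbrs u = (False, True, True, True, True)"
  shows "\<exists>f. bij_betw f V (verts A6) \<and> (\<forall>y\<in>V. \<forall>z\<in>V. E y z \<longleftrightarrow> {f y, f z} \<in> edges A6)"
proof -
  have u_out: "u \<notin> B"
    using u(2) bull bull_sym irrefl by (auto simp: nbrs_def)
  have only: "w \<in> B \<union> {u}" if w: "w \<in> V" for w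
  proof (rule ccontr)
    assume no: "w \<notin> B \<union> {u}"
    then have out: "w \<notin> B" "u \<noteq> w" by auto
    note pair = outside_pair[OF u(1) u_out w out]
    \<comment> \<open>Whichever row \<open>w\<close> has, some of these constraints require the edge
      \<open>u w\<close> and others exclude it.\<close>
    show False
      using outside[OF w out(1)] u(2) pair(4,5,8,11,12,13) unfolding nbrs_def by auto
  qed
  then have V: "V = {x, t1, t2, s1, s2, u}" using B_subset u(1) by auto
  have bits: "\<not> E u x" "E u t1" "E u t2" "E u s1" "E u s2" using u(2) by (auto simp: nbrs_def)
  then have bits': "\<not> E x u" "E t1 u" "E t2 u" "E s1 u" "E s2 u" using sym by blast+
  have ne: "u \<noteq> x" "u \<noteq> t1" "u \<noteq> t2" "u \<noteq> s1" "u \<noteq> s2" using u_out by auto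
  \<comment> \<open>The central triangle is \<open>u, t1, t2\<close>; the corners opposite to them
    are \<open>x\<close>, \<open>s2\<close>, \<open>s1\<close> in this order.\<close>
  define f :: "'a \<Rightarrow> nat" where
    "f = (\<lambda>_. 0)(t1 := 1, t2 := 2, x := 3, s2 := 4, s1 := 5)"
  have f: "f u = 0" "f t1 = 1" "f t2 = 2" "f x = 3" "f s2 = 4" "f s1 = 5"
    unfolding f_def using ne B_distinct_sym by simp_all
  have "inj_on f V" unfolding V by (auto simp: inj_on_def f)
  moreover have "f ` V = verts A6" unfolding V by (auto simp: f A6_def)
  moreover have "\<forall>y\<in>V. \<forall>z\<in>V. E y z \<longleftrightarrow> {f y, f z} \<in> edges A6"
    unfolding V by (simp add: f A6_def doubleton_eq_iff bits bits' bull bull_sym irrefl)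
  ultimately show ?thesis unfolding bij_betw_def by blast
qed

lemma P9_case:
  assumes no: "\<And>u. u \<in> V \<Longrightarrow> nbrs u \<noteq> (False, True, True, True, True)"
    "\<And>u. u \<in> V \<Longrightarrow> nbrs u \<noteq> (True, False, False, False, False)"
  shows "\<exists>f. inj_on f V \<and> f ` V \<subseteq> verts P9 \<and>
    (\<forall>y\<in>V. \<forall>z\<in>V. E y z \<longleftrightarrow> {f y, f z} \<in> edges P9)"
proof -
  \<comment> \<open>For vertices of \<open>V\<close> off the bull the three tests separate the four
    remaining rows, so the final branch is reached only with the row of
    \<open>(1, 0)\<close>.\<close>
  define f :: "'a \<Rightarrow> nat \<times> nat" where
    "f v = (if v = x then (0, 0) else if v = t1 then (0, 1) else if v = t2 then (0, 2)
      else if v = s1 then (1, 1) else if v = s2 then (2, 2)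
      else if E v t2 then (1, 2) else if E v t1 then (2, 1) else if E v s2 then (2, 0)
      else (1, 0))" for v
  have fB: "f x = (0, 0)" "f t1 = (0, 1)" "f t2 = (0, 2)" "f s1 = (1, 1)" "f s2 = (2, 2)"
    using B_distinct_sym by (simp_all add: f_def)
  have out: "f v = (1, 2) \<and> \<not> E v x \<and> \<not> E v t1 \<and> E v t2 \<and> E v s1 \<and> E v s2 \<or>
      f v = (2, 1) \<and> \<not> E v x \<and> E v t1 \<and> \<not> E v t2 \<and> E v s1 \<and> E v s2 \<or>
      f v = (2, 0) \<and> E v x \<and> \<not> E v t1 \<and> \<not> E v t2 \<and> \<not> E v s1 \<and> E v s2 \<or>
      f v = (1, 0) \<and> E v x \<and> \<not> E v t1 \<and> \<not> E v t2 \<and> E v s1 \<and> \<not> E v s2"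
    if v: "v \<in> V" "v \<notin> B" for v
  proof -
    from v(2) have "f v = (if E v t2 then (1, 2) else if E v t1 then (2, 1)
      else if E v s2 then (2, 0) else (1, 0))" by (simp add: f_def)
    then show ?thesis
      using outside[OF v] no[OF v(1)] unfolding nbrs_def by (auto split: if_splits)
  qed
  have sv: "E x z = E z x" "E t1 z = E z t1" "E t2 z = E z t2" "E s1 z = E z s1" "E s2 z = E z s2" for z
    using sym by blast+
  have range: "fst (f v) < 3 \<and> snd (f v) < 3" if "v \<in> V" for v
    using out[OF that] fB by (cases "v \<in> B") auto
  have in_in: "E v w \<longleftrightarrow> {f v, f w} \<in> edges P9" if "v \<in> B" "w \<in> B" for v w
    using that by (auto simp: fB P9_edge_iff bull bull_sym irrefl)
  have in_out: "f v \<noteq> f w \<and> (E w v \<longleftrightarrow> {f v, f w} \<in> edges P9)" if "v \<in> B" "w \<in> V" "w \<notin> B" for v w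
    using that(1) out[OF that(2,3)] by (auto simp: fB P9_edge_iff)
  have out_out: "f v \<noteq> f w \<and> (E v w \<longleftrightarrow> {f v, f w} \<in> edges P9)"
    if "v \<in> V" "v \<notin> B" "w \<in> V" "w \<notin> B" "v \<noteq> w" for v w
  proof -
    have "E w v = E v w" using sym by blast
    then show ?thesis
      using outside_pair[OF that] outside_pair[OF that(3,4,1,2) that(5)[symmetric]]
        out[OF that(1,2)] out[OF that(3,4)]
      by (elim disjE conjE) (simp_all add: P9_edge_iff)
  qed
  have "inj_on f V"
  proof (rule inj_onI, rule ccontr)
    fix v w assume "v \<in> V" "w \<in> V" "f v = f w" "v \<noteq> w"
    then show False
      using in_out[of v w] in_out[of w v] out_out[of v w] fB
      by (cases "v \<in> B"; cases "w \<in> B") auto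
  qed
  moreover have "f ` V \<subseteq> verts P9"
    using range by (simp add: P9_def image_subset_iff mem_Times_iff)
  moreover have "E v w \<longleftrightarrow> {f v, f w} \<in> edges P9" if "v \<in> V" "w \<in> V" for v w
  proof -
    consider "v \<in> B" "w \<in> B" | "v \<in> B" "w \<notin> B" | "v \<notin> B" "w \<in> B" | "v \<notin> B" "w \<notin> B" by blast
    then show ?thesis
    proof cases
      case 1
      then show ?thesis by (rule in_in)
    next
      case 2
      then show ?thesis using in_out[of v w] that(2) sym by blast
    next
      case 3
      then show ?thesis using in_out[of w v] that(1) by (simp add: insert_commute)
    next
      case 4
      then show ?thesis
        using out_out[OF that(1) 4(1) that(2) 4(2)] irrefl[of w]
          P9_edge_iff[of "f w" "f w"]
        by (cases "v = w") auto
    qed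
  qed
  ultimately show ?thesis by blast
qed

text \<open>In the complement \<open>x, s1, s2\<close> is the triangle. The pendant edges are now
  the former non-edges \<open>s1 t2\<close> and \<open>s2 t1\<close>, hence the reversed order of
  \<open>t2\<close> and \<open>t1\<close>.\<close>

lemma bull_dual: "bull V co x s1 s2 t2 t1"
proof -
  interpret d: claw_coclaw_free V co by (rule dual)
  show ?thesis
    by unfold_locales (use B_subset B_distinct_sym bull bull_sym in \<open>simp_all add: co_def\<close>)
qed

lemma A6_or_P9:
  "(\<exists>f. bij_betw f V (verts A6) \<and> (\<forall>y\<in>V. \<forall>z\<in>V. E y z \<longleftrightarrow> {f y, f z} \<in> edges A6)) \<or>
   (\<exists>f. bij_betw f V (verts A6) \<and> (\<forall>y\<in>V. \<forall>z\<in>V. co y z \<longleftrightarrow> {f y, f z} \<in> edges A6)) \<or>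
   (\<exists>f. inj_on f V \<and> f ` V \<subseteq> verts P9 \<and> (\<forall>y\<in>V. \<forall>z\<in>V. E y z \<longleftrightarrow> {f y, f z} \<in> edges P9))"
proof -
  interpret d: bull V co x s1 s2 t2 t1 by (rule bull_dual)
  \<comment> \<open>A vertex adjacent to \<open>x\<close> alone is, in the complement, adjacent to
    all of the bull except \<open>x\<close>.\<close>
  have "d.nbrs u = (False, True, True, True, True)"
    if "u \<in> V" "nbrs u = (True, False, False, False, False)" for u
  proof -
    have "u \<notin> B" using that(2) bull bull_sym irrefl by (auto simp: nbrs_def)
    then show ?thesis using that B_subset by (auto simp: nbrs_def d.nbrs_def co_def)
  qed
  then show ?thesis using A6_case d.A6_case P9_case by blast
qed

end

section \<open>Existence of a bull\<close>

context claw_coclaw_free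
begin

text \<open>Each of \<open>s1\<close>, \<open>s2\<close> has a neighbour among \<open>t1\<close>,
  \<open>t2\<close>, as otherwise it would be isolated from the triangle; neither \<open>t1\<close>
  nor \<open>t2\<close> is adjacent to both, as it would be the centre of a claw with leaves
  \<open>x, s1, s2\<close>. So the edges between the pairs form a perfect matching, and the two
  cases are the two matchings.\<close>

lemma bull_exists_shared:
  assumes tri: "E x t1" "E x t2" "E t1 t2" and ind: "co x s1" "co x s2" "co s1 s2"
  shows "\<exists>t1 t2 s1 s2. bull V E x t1 t2 s1 s2"
proof -
  have s: "s1 \<in> V" "s2 \<in> V" "s1 \<noteq> s2" "\<not> E x s1" "\<not> E x s2" "\<not> E s1 s2" "x \<noteq> s1" "x \<noteq> s2"
    using ind by (auto simp: co_def)
  have t: "E t1 x" "E t2 x" "E t2 t1" using tri sym by blast+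
  have "t1 \<noteq> s1" "t1 \<noteq> s2" "t2 \<noteq> s1" "t2 \<noteq> s2" using tri s by auto
  then have "E s1 t1 \<or> E s1 t2" "E s2 t1 \<or> E s2 t2"
    using coclaw[of x t1 t2 s1] coclaw[of x t1 t2 s2] tri s sym by blast+
  then have st: "E t1 s1 \<or> E t2 s1" "E t1 s2 \<or> E t2 s2" using sym by blast+
  have "\<not> (E t1 s1 \<and> E t1 s2)" "\<not> (E t2 s1 \<and> E t2 s2)"
    using claw[of t1 x s1 s2] claw[of t2 x s1 s2] t s by blast+
  with st consider "E t1 s1" "E t2 s2" "\<not> E t1 s2" "\<not> E t2 s1"
    | "E t2 s1" "E t1 s2" "\<not> E t2 s2" "\<not> E t1 s1" by blast
  then show ?thesis
  proof cases
    case 1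
    then have "bull V E x t1 t2 s1 s2" using tri s by unfold_locales auto
    then show ?thesis by blast
  next
    case 2
    then have "bull V E x t2 t1 s1 s2" using tri t s by unfold_locales auto
    then show ?thesis by blast
  qed
qed

lemma bull_exists:
  assumes tri: "E a b" "E a c" "E b c" and ind: "co p q" "co p r" "co q r"
  shows "\<exists>x t1 t2 s1 s2. bull V E x t1 t2 s1 s2"
proof (rule ccontr)
  assume "\<not> ?thesis"
  then have sh: False if "E x t1" "E x t2" "E t1 t2" "co x s1" "co x s2" "co s1 s2" for x t1 t2 s1 s2
    using bull_exists_shared[OF that] by blast
  have tri': "E b a" "E c a" "E c b" using tri sym by blast+
  have ind': "co q p" "co r p" "co r q" using ind sym by (auto simp: co_def)
  have V: "a \<in> V" "b \<in> V" "c \<in> V" using tri vertices by blast+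
  have disj: "s \<noteq> a" "s \<noteq> b" "s \<noteq> c" if "s \<in> {p, q, r}" for s
    using that sh tri tri' ind ind' by blast+
  text \<open>Counting the edges between the triangle and the independent set: each of \<open>p, q, r\<close> has at
    most one neighbour in the triangle, each of \<open>a, b, c\<close> has at least two in the
    independent set.\<close>
  have one: "\<not> (E s t \<and> E s t')"
    if s: "s \<in> {p, q, r}" and "t \<in> {a, b, c}" "t' \<in> {a, b, c}" "t \<noteq> t'" for s t t'
  proof
    assume st: "E s t \<and> E s t'"
    \<comment> \<open>\<open>s, t, t'\<close> would be a triangle sharing \<open>s\<close> with the
      independent set.\<close>
    have "E t t'" using that tri tri' by auto
    moreover obtain s' s'' where "co s s'" "co s s''" "co s' s''"
      using s ind ind' by blast
    ultimately show False using sh st by blast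
  qed
  have two: "E t s \<or> E t s'"
    if t: "t \<in> {a, b, c}" and "s \<in> {p, q, r}" "s' \<in> {p, q, r}" "s \<noteq> s'" for t s s'
  proof (rule ccontr)
    assume "\<not> (E t s \<or> E t s')"
    \<comment> \<open>Dually, \<open>t, s, s'\<close> would be an independent set sharing
      \<open>t\<close> with the triangle.\<close>
    then have "co t s" "co t s'" using that disj V ind by (auto simp: co_def)
    moreover have "co s s'" using that ind ind' by auto
    moreover obtain t' t'' where "E t t'" "E t t''" "E t' t''"
      using t tri tri' by blast
    ultimately show False using sh by blast
  qed
  have ne: "a \<noteq> b" "a \<noteq> c" "b \<noteq> c" "p \<noteq> q" "p \<noteq> r" "q \<noteq> r"
    using tri ind irrefl by (auto simp: co_def)
  have pqr: "\<not> (E s a \<and> E s b)" "\<not> (E s a \<and> E s c)" "\<not> (E s b \<and> E s c)" if "s \<in> {p, q, r}" for s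
    using one[OF that] ne by blast+
  have abc: "E p t \<or> E q t" "E p t \<or> E r t" "E q t \<or> E r t" if "t \<in> {a, b, c}" for t
    using two[OF that] ne sym by blast+
  \<comment> \<open>At most three edges counted from \<open>p, q, r\<close>, at least six counted
    from \<open>a, b, c\<close>.\<close>
  show False using pqr[of p] pqr[of q] pqr[of r] abc[of a] abc[of b] abc[of c] by auto
qed

end

section \<open>Induced subgraphs and complements\<close>

definition adj :: "'a graph \<Rightarrow> 'a \<Rightarrow> 'a \<Rightarrow> bool" where
  "adj G x y \<longleftrightarrow> {x, y} \<in> edges G"

lemma adj_sym: "adj G x y \<Longrightarrow> adj G y x"
  by (simp add: adj_def insert_commute)

lemma adj_verts: "is_graph G \<Longrightarrow> adj G x y \<Longrightarrow> x \<in> verts G \<and> y \<in> verts G \<and> x \<noteq> y"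
  using subsetD[of "edges G" "[verts G]\<^bsup>2\<^esup>" "{x, y}"] by (simp add: is_graph_def adj_def)

lemma adj_irrefl: "is_graph G \<Longrightarrow> \<not> adj G x x"
  using adj_verts[of G x x] by auto

lemma verts_complement [simp]: "verts (complement G) = verts G"
  by (simp add: complement_def)

lemma adj_complement:
  "adj (complement G) x y \<longleftrightarrow> x \<in> verts G \<and> y \<in> verts G \<and> x \<noteq> y \<and> \<not> adj G x y"
  by (auto simp: complement_def adj_def)

lemma is_graph_complement: "is_graph (complement G)"
  by (auto simp: is_graph_def complement_def)

lemma complement_complement: "is_graph G \<Longrightarrow> complement (complement G) = G"
  by (cases G) (auto simp: is_graph_def complement_def)

lemma adj_induced: "adj (induced G S) x y \<longleftrightarrow> x \<in> S \<and> y \<in> S \<and> x \<noteq> y \<and> adj G x y"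
  by (auto simp: induced_def adj_def)

text \<open>Embeddings replace the choice of a vertex subset. Since \<open>isomorphic\<close> also
  compares the degenerate pairs \<open>{x, x}\<close>, the absence of loops in \<open>G\<close>
  enters here.\<close>

lemma isomorphic_to_induced_iff:
  assumes G: "is_graph G" and H: "is_graph H"
  shows "isomorphic_to_induced H G \<longleftrightarrow>
    (\<exists>f. inj_on f (verts H) \<and> f ` verts H \<subseteq> verts G \<and>
      (\<forall>x\<in>verts H. \<forall>y\<in>verts H. adj H x y \<longleftrightarrow> adj G (f x) (f y)))"
proof
  assume "isomorphic_to_induced H G"
  then obtain X f where X: "X \<subseteq> verts G" and f: "bij_betw f (verts H) X"
    and a: "\<And>x y. x \<in> verts H \<Longrightarrow> y \<in> verts H \<Longrightarrow> adj H x y \<longleftrightarrow> adj (induced G X) (f x) (f y)"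
    unfolding isomorphic_to_induced_def isomorphic_def adj_def by (auto simp: induced_def)
  have "adj H x y \<longleftrightarrow> adj G (f x) (f y)" if "x \<in> verts H" "y \<in> verts H" for x y
    using a[OF that] f that adj_irrefl[OF G, of "f x"] unfolding adj_induced
    by (auto simp: bij_betw_def)
  then show "\<exists>f. inj_on f (verts H) \<and> f ` verts H \<subseteq> verts G \<and>
      (\<forall>x\<in>verts H. \<forall>y\<in>verts H. adj H x y \<longleftrightarrow> adj G (f x) (f y))"
    using f X unfolding bij_betw_def by blast
next
  assume "\<exists>f. inj_on f (verts H) \<and> f ` verts H \<subseteq> verts G \<and>
      (\<forall>x\<in>verts H. \<forall>y\<in>verts H. adj H x y \<longleftrightarrow> adj G (f x) (f y))"
  then obtain f where f: "inj_on f (verts H)" "f ` verts H \<subseteq> verts G"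
    and a: "\<And>x y. x \<in> verts H \<Longrightarrow> y \<in> verts H \<Longrightarrow> adj H x y \<longleftrightarrow> adj G (f x) (f y)" by metis
  have "adj H x y \<longleftrightarrow> adj (induced G (f ` verts H)) (f x) (f y)"
    if "x \<in> verts H" "y \<in> verts H" for x y
    using a[OF that] that adj_irrefl[OF G, of "f x"] unfolding adj_induced by auto
  then have "isomorphic H (induced G (f ` verts H))"
    unfolding isomorphic_def adj_def[symmetric] using f(1) by (auto simp: bij_betw_def induced_def)
  then show "isomorphic_to_induced H G"
    unfolding isomorphic_to_induced_def using f(2) by blast
qed

text \<open>The same map serves both sides: an embedding preserves non-adjacency too, and
  injectivity preserves distinctness.\<close>

lemma isomorphic_to_induced_complement:
  assumes G: "is_graph G" and H: "is_graph H"
  shows "isomorphic_to_induced (complement H) G \<longleftrightarrow> isomorphic_to_induced H (complement G)"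
proof -
  have "adj (complement H) x y = adj G (f x) (f y) \<longleftrightarrow> adj H x y = adj (complement G) (f x) (f y)"
    if "inj_on f (verts H)" "f ` verts H \<subseteq> verts G" "x \<in> verts H" "y \<in> verts H" for f x y
  proof -
    have "f x \<in> verts G" "f y \<in> verts G" "f x = f y \<longleftrightarrow> x = y"
      using that by (auto dest: inj_onD)
    then show ?thesis
      using that(3,4) adj_irrefl[OF G, of "f x"] adj_irrefl[OF H, of x]
      unfolding adj_complement by (cases "x = y") auto
  qed
  then show ?thesis
    unfolding isomorphic_to_induced_iff[OF G is_graph_complement]
      isomorphic_to_induced_iff[OF is_graph_complement H] verts_complement
    by (intro ex_cong1 conj_cong ball_cong refl)
qed

section \<open>The forbidden subgraphs as conditions on four vertices\<close>

lemma is_graph_K13: "is_graph K13"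
  by (simp add: is_graph_def K13_def)

lemma claw_iff:
  assumes G: "is_graph G"
  shows "isomorphic_to_induced K13 G \<longleftrightarrow>
    (\<exists>x a b c. x \<in> verts G \<and> a \<in> verts G \<and> b \<in> verts G \<and> c \<in> verts G \<and>
      a \<noteq> b \<and> a \<noteq> c \<and> b \<noteq> c \<and>
      adj G x a \<and> adj G x b \<and> adj G x c \<and> \<not> adj G a b \<and> \<not> adj G a c \<and> \<not> adj G b c)"
    (is "_ \<longleftrightarrow> ?claw")
proof
  assume "isomorphic_to_induced K13 G"
  then obtain f :: "nat \<Rightarrow> 'a" where f: "inj_on f (verts K13)" "f ` verts K13 \<subseteq> verts G"
    "\<forall>x\<in>verts K13. \<forall>y\<in>verts K13. adj K13 x y \<longleftrightarrow> adj G (f x) (f y)"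
    using isomorphic_to_induced_iff[OF G is_graph_K13] by blast
  have "f 1 \<noteq> f 2" "f 1 \<noteq> f 3" "f 2 \<noteq> f 3" using f(1) by (auto simp: K13_def inj_on_def)
  moreover have "adj G (f 0) (f 1)" "adj G (f 0) (f 2)" "adj G (f 0) (f 3)"
      "\<not> adj G (f 1) (f 2)" "\<not> adj G (f 1) (f 3)" "\<not> adj G (f 2) (f 3)"
    unfolding adj_def using f(3) by (simp_all add: K13_def adj_def doubleton_eq_iff)
  ultimately show ?claw using adj_verts[OF G] by blast
next
  assume ?claw
  then obtain x a b c where *: "a \<noteq> b" "a \<noteq> c" "b \<noteq> c" "adj G x a" "adj G x b" "adj G x c"
    "\<not> adj G a b" "\<not> adj G a c" "\<not> adj G b c" by blast
  define f :: "nat \<Rightarrow> 'a" where "f = (\<lambda>_. x)(1 := a, 2 := b, 3 := c)"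
  have f: "f 0 = x" "f 1 = a" "f (Suc 0) = a" "f 2 = b" "f 3 = c" by (simp_all add: f_def)
  have v: "x \<in> verts G" "a \<in> verts G" "b \<in> verts G" "c \<in> verts G" "x \<noteq> a" "x \<noteq> b" "x \<noteq> c"
    using * adj_verts[OF G] by blast+
  have sym: "adj G a x" "adj G b x" "adj G c x" "\<not> adj G b a" "\<not> adj G c a" "\<not> adj G c b"
    using * adj_sym by metis+
  have "inj_on f (verts K13)" using * v by (auto simp: K13_def inj_on_def f)
  moreover have "f ` verts K13 \<subseteq> verts G" using v by (simp add: K13_def f)
  moreover have "\<forall>y\<in>verts K13. \<forall>z\<in>verts K13. adj K13 y z \<longleftrightarrow> adj G (f y) (f z)"
    using * sym
    adj_irrefl[OF G] by (simp add: adj_def K13_def f doubleton_eq_iff)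
  ultimately show "isomorphic_to_induced K13 G"
    using isomorphic_to_induced_iff[OF G is_graph_K13] by blast
qed

lemma Forb_claw_iff:
  assumes G: "is_graph G"
  shows "G \<in> Forb {K13, complement K13} \<longleftrightarrow> claw_coclaw_free (verts G) (adj G)"
proof -
  have "G \<in> Forb {K13, complement K13} \<longleftrightarrow>
      \<not> isomorphic_to_induced K13 G \<and> \<not> isomorphic_to_induced K13 (complement G)"
    using G isomorphic_to_induced_complement[OF G is_graph_K13] by (simp add: Forb_def)
  also have "\<dots> \<longleftrightarrow> claw_coclaw_free (verts G) (adj G)"
  proof
    assume no: "\<not> isomorphic_to_induced K13 G \<and> \<not> isomorphic_to_induced K13 (complement G)"
    show "claw_coclaw_free (verts G) (adj G)"
    proof
      show "adj G a b \<or> adj G a c \<or> adj G b c"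
        if "adj G x a" "adj G x b" "adj G x c" "a \<noteq> b" "a \<noteq> c" "b \<noteq> c" for x a b c
        using no that adj_verts[OF G] unfolding claw_iff[OF G] by blast
      show "adj G x a \<or> adj G x b \<or> adj G x c"
        if "adj G a b" "adj G a c" "adj G b c" "x \<in> verts G" "x \<noteq> a" "x \<noteq> b" "x \<noteq> c" for a b c x
      proof (rule ccontr)
        assume "\<not> ?thesis"
        then have "isomorphic_to_induced K13 (complement G)"
          unfolding claw_iff[OF is_graph_complement] adj_complement verts_complement
          using that adj_verts[OF G that(1)] adj_verts[OF G that(2)] adj_verts[OF G that(3)]
          by blast
        then show False using no by blast
      qed
      show "adj G y x" if "adj G x y" for x y using adj_sym[OF that] .
      show "\<not> adj G x x" for x using adj_irrefl[OF G] .
      show "x \<in> verts G" if "adj G x y" for x y using adj_verts[OF G that] ..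
    qed
  next
    assume "claw_coclaw_free (verts G) (adj G)"
    then interpret claw_coclaw_free "verts G" "adj G" .
    have "\<not> isomorphic_to_induced K13 G"
      unfolding claw_iff[OF G] using claw by blast
    moreover have "\<not> isomorphic_to_induced K13 (complement G)"
    proof
      assume "isomorphic_to_induced K13 (complement G)"
      then obtain x a b c where "x \<in> verts G" "adj G a b" "adj G a c" "adj G b c"
        "x \<noteq> a" "x \<noteq> b" "x \<noteq> c" "\<not> adj G x a" "\<not> adj G x b" "\<not> adj G x c"
        unfolding claw_iff[OF is_graph_complement] adj_complement verts_complement by blast
      then show False using coclaw by blast
    qed
    ultimately show "\<not> isomorphic_to_induced K13 G \<and> \<not> isomorphic_to_induced K13 (complement G)" ..
  qed
  finally show ?thesis .
qed

text \<open>Both axioms concern four vertices at a time, so they pass back along any embedding; this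
  covers copies of \<open>A6\<close> and induced subgraphs of \<open>P9\<close> alike.\<close>

lemma claw_coclaw_free_transfer:
  assumes "claw_coclaw_free W F" and f: "inj_on f V" "f ` V \<subseteq> W"
    and E: "\<And>x y. x \<in> V \<Longrightarrow> y \<in> V \<Longrightarrow> E x y \<longleftrightarrow> F (f x) (f y)"
    and V: "\<And>x y. E x y \<Longrightarrow> x \<in> V \<and> y \<in> V"
  shows "claw_coclaw_free V E"
proof -
  interpret W: claw_coclaw_free W F by fact
  have ne: "f x \<noteq> f y" if "x \<noteq> y" "x \<in> V" "y \<in> V" for x y using that f(1) by (auto dest: inj_onD)
  show ?thesis
  proof
    show "E y x" if "E x y" for x y using that V[OF that] E W.sym by blast
    show "\<not> E x x" for x using V[of x x] E[of x x] W.irrefl by blast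
    show "x \<in> V" if "E x y" for x y using V[OF that] by blast
    show "E a b \<or> E a c \<or> E b c"
      if "E x a" "E x b" "E x c" "a \<noteq> b" "a \<noteq> c" "b \<noteq> c" for x a b c
      using W.claw[of "f x" "f a" "f b" "f c"] V[OF that(1)] V[OF that(2)] V[OF that(3)] that E ne
      by simp
    show "E x a \<or> E x b \<or> E x c"
      if "E a b" "E a c" "E b c" "x \<in> V" "x \<noteq> a" "x \<noteq> b" "x \<noteq> c" for x a b c
      using W.coclaw[of "f a" "f b" "f c" "f x"] V[OF that(1)] V[OF that(2)] that(4-) that(1-3) E ne f(2)
      by auto
  qed
qed

section \<open>The graphs \<open>A\<^sub>6\<close> and \<open>P\<^sub>9\<close>\<close>

text \<open>The neighbours of a point lie on its row and its column, so two of any three share a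
  line and are adjacent. A triangle is a full row or column; its varying coordinate takes all three
  values, so a point off it agrees there with one of its points.\<close>

lemma claw_coclaw_free_P9: "claw_coclaw_free (verts P9) (adj P9)"
proof -
  have verts: "p \<in> verts P9 \<longleftrightarrow> fst p < 3 \<and> snd p < 3" for p
    by (cases p) (simp add: P9_def)
  have covered: "k = l \<or> k = m \<or> k = n"
    if "k < 3" "l < 3" "m < 3" "n < 3" "l \<noteq> m" "l \<noteq> n" "m \<noteq> n" for k l m n :: nat
    using that by arith
  show ?thesis
    unfolding adj_def
  proof
    show "{a, b} \<in> edges P9 \<or> {a, c} \<in> edges P9 \<or> {b, c} \<in> edges P9"
      if "{x, a} \<in> edges P9" "{x, b} \<in> edges P9" "{x, c} \<in> edges P9" "a \<noteq> b" "a \<noteq> c" "b \<noteq> c" for x a b c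
      using that unfolding P9_edge_iff prod_eq_iff by metis
    show "{x, a} \<in> edges P9 \<or> {x, b} \<in> edges P9 \<or> {x, c} \<in> edges P9"
      if "{a, b} \<in> edges P9" "{a, c} \<in> edges P9" "{b, c} \<in> edges P9" "x \<in> verts P9"
        "x \<noteq> a" "x \<noteq> b" "x \<noteq> c" for a b c x
      using that covered[of "fst x" "fst a" "fst b" "fst c"] covered[of "snd x" "snd a" "snd b" "snd c"]
      unfolding P9_edge_iff prod_eq_iff verts by metis
    show "{x, x} \<notin> edges P9" for x unfolding P9_edge_iff by simp
  qed (auto simp: P9_edge_iff verts)
qed

text \<open>In the encoding \<open>i + 3\<close> is the corner opposite to the inner vertex
  \<open>i\<close>; the non-edges are the pairs of corners and the three opposite pairs.\<close>

lemma adj_A6: "adj A6 i j \<longleftrightarrow>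
    i < 6 \<and> j < 6 \<and> i \<noteq> j \<and> (i < 3 \<or> j < 3) \<and> i \<noteq> j + 3 \<and> j \<noteq> i + 3"
proof (cases "i < 6 \<and> j < 6")
  case True
  then have "i = 0 \<or> i = 1 \<or> i = 2 \<or> i = 3 \<or> i = 4 \<or> i = 5"
    "j = 0 \<or> j = 1 \<or> j = 2 \<or> j = 3 \<or> j = 4 \<or> j = 5" by arith+
  then show ?thesis
    by (elim disjE; simp add: adj_def A6_def doubleton_eq_iff)
next
  case False
  then show ?thesis by (auto simp: adj_def A6_def doubleton_eq_iff)
qed

text \<open>Three independent vertices must be the three corners, and an inner vertex misses the one
  opposite to it. A triangle has two inner vertices, and a vertex off it cannot be opposite to
  both.\<close>

lemma claw_coclaw_free_A6: "claw_coclaw_free (verts A6) (adj A6)"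
proof -
  have verts: "i \<in> verts A6 \<longleftrightarrow> i < 6" for i
    by (auto simp: A6_def)
  show ?thesis
  proof
    have non: "3 \<le> i \<and> 3 \<le> j \<or> i = j + 3 \<or> j = i + 3"
      if "\<not> adj A6 i j" "i \<noteq> j" "i < 6" "j < 6" for i j
      using that unfolding adj_A6 by linarith
    show "adj A6 a b \<or> adj A6 a c \<or> adj A6 b c"
      if *: "adj A6 x a" "adj A6 x b" "adj A6 x c" and ne: "a \<noteq> b" "a \<noteq> c" "b \<noteq> c" for x a b c
    proof (rule ccontr)
      assume "\<not> ?thesis"
      then have ab: "\<not> adj A6 a b" and ac: "\<not> adj A6 a c" and bc: "\<not> adj A6 b c" by simp_all
      have lt: "a < 6" "b < 6" "c < 6" using * by (simp_all add: adj_A6)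
      have "3 \<le> a" using non[OF ab ne(1) lt(1,2)] non[OF ac ne(2) lt(1,3)] ne lt by linarith
      moreover have "3 \<le> b" using non[OF ab ne(1) lt(1,2)] non[OF bc ne(3) lt(2,3)] ne lt by linarith
      moreover have "3 \<le> c" using non[OF ac ne(2) lt(1,3)] non[OF bc ne(3) lt(2,3)] ne lt by linarith
      moreover have "x < 3" "a \<noteq> x + 3" "b \<noteq> x + 3" "c \<noteq> x + 3"
        using * \<open>3 \<le> a\<close> by (simp_all add: adj_A6)
      ultimately show False using ne lt by linarith
    qed
    show "adj A6 x a \<or> adj A6 x b \<or> adj A6 x c"
      if *: "adj A6 a b" "adj A6 a c" "adj A6 b c"
        and x: "x \<in> verts A6" "x \<noteq> a" "x \<noteq> b" "x \<noteq> c" for a b c x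
    proof (rule ccontr)
      assume "\<not> ?thesis"
      then have xa: "\<not> adj A6 x a" and xb: "\<not> adj A6 x b" and xc: "\<not> adj A6 x c" by simp_all
      have lt: "a < 6" "b < 6" "c < 6" "x < 6" using * x(1) by (simp_all add: adj_A6 verts)
      have ne: "a \<noteq> b" "a \<noteq> c" "b \<noteq> c" using * by (simp_all add: adj_A6)
      have "a < 3 \<or> b < 3" "a < 3 \<or> c < 3" "b < 3 \<or> c < 3" using * by (simp_all add: adj_A6)
      moreover have "a < 3 \<Longrightarrow> x = a + 3" using non[OF xa x(2) lt(4,1)] by linarith
      moreover have "b < 3 \<Longrightarrow> x = b + 3" using non[OF xb x(3) lt(4,2)] by linarith
      moreover have "c < 3 \<Longrightarrow> x = c + 3" using non[OF xc x(4) lt(4,3)] by linarith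
      ultimately show False using ne by auto
    qed
  qed (auto simp: adj_A6 verts)
qed

section \<open>Graphs whose components are paths and cycles\<close>

definition triangle_free_degree_2 :: "'a graph \<Rightarrow> bool" where
  "triangle_free_degree_2 G \<longleftrightarrow> max_degree_2 (adj G) \<and>
    (\<forall>x y z. adj G x y \<longrightarrow> adj G y z \<longrightarrow> \<not> adj G z x)"

lemma adj_path_graph:
  "adj (path_graph n) a b \<longleftrightarrow> a < n \<and> b < n \<and> (a = Suc b \<or> b = Suc a)"
  by (auto simp: adj_def path_graph_def doubleton_eq_iff)

lemma adj_one_way_infinite_path:
  "adj one_way_infinite_path a b \<longleftrightarrow> a = Suc b \<or> b = Suc a"
  by (auto simp: adj_def one_way_infinite_path_def doubleton_eq_iff)

lemma adj_two_way_infinite_path: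
  "adj two_way_infinite_path a b \<longleftrightarrow> a = b + 1 \<or> b = a + 1"
  by (auto simp: adj_def two_way_infinite_path_def doubleton_eq_iff)

lemma adj_cycle_graph:
  "adj (cycle_graph n) a b \<longleftrightarrow> a < n \<and> b < n \<and> (a = Suc b mod n \<or> b = Suc a mod n)"
  by (auto simp: adj_def cycle_graph_def doubleton_eq_iff)

lemma isomorphic_induced_iff:
  assumes G: "is_graph G" and H: "\<And>x. \<not> adj H x x"
  shows "isomorphic (induced G S) H \<longleftrightarrow> (\<exists>f. bij_betw f S (verts H) \<and>
    (\<forall>x\<in>S. \<forall>y\<in>S. adj G x y \<longleftrightarrow> adj H (f x) (f y)))"
proof -
  have "adj (induced G S) x y = adj H (f x) (f y) \<longleftrightarrow> adj G x y = adj H (f x) (f y)"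
    if "x \<in> S" "y \<in> S" for f x y
    using that H[of "f x"] adj_irrefl[OF G, of x] by (cases "x = y") (auto simp: adj_induced)
  moreover have "verts (induced G S) = S" by (simp add: induced_def)
  ultimately show ?thesis unfolding isomorphic_def adj_def[symmetric] by simp
qed

lemma components_eq:
  assumes G: "is_graph G"
  shows "components G = {induced G (reach (adj G) v) | v. v \<in> verts G}"
proof -
  have "{w \<in> verts G. (v, w) \<in> (adjacent G)\<^sup>*} = reach (adj G) v" if "v \<in> verts G" for v
  proof -
    have "reach (adj G) v \<subseteq> verts G"
      by (rule reach_least) (use that adj_verts[OF G] in auto)
    moreover have "adjacent G = arcs (adj G)" by (simp add: adjacent_def arcs_def adj_def)
    ultimately show ?thesis by (auto simp: reach_def)
  qed
  then show ?thesis unfolding components_def by (intro Collect_cong ex_cong1) auto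
qed

lemma downward_closed_nat_set:
  assumes "\<And>m k :: nat. m \<in> A \<Longrightarrow> k \<le> m \<Longrightarrow> k \<in> A"
  shows "A = UNIV \<or> (\<exists>n. A = {..<n})"
proof (cases "A = UNIV")
  case False
  define n where "n = (LEAST n. n \<notin> A)"
  have "n \<notin> A" unfolding n_def using False by (metis LeastI UNIV_eq_I)
  moreover have "k \<in> A" if "k < n" for k using not_less_Least that unfolding n_def by blast
  ultimately have "A = {..<n}" using assms by (metis lessThan_iff linorder_not_less subsetI subset_antisym)
  then show ?thesis by blast
qed simp

lemma components_of_triangle_free_degree_2:
  assumes G: "is_graph G" and thin: "triangle_free_degree_2 G"
  shows "components_cycles_or_paths G"
  unfolding components_cycles_or_paths_def
proof
  fix C assume "C \<in> components G"
  then obtain v where C: "C = induced G (reach (adj G) v)" unfolding components_eq[OF G] by blast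
  let ?S = "reach (adj G) v"
  have iso: "isomorphic (induced G ?S) H"
    if "\<And>x. \<not> adj H x x" "bij_betw f ?S (verts H)"
      "\<And>x y. x \<in> ?S \<Longrightarrow> y \<in> ?S \<Longrightarrow> adj G x y \<longleftrightarrow> adj H (f x) (f y)" for f and H :: "'c graph"
    using isomorphic_induced_iff[OF G, of H] that by blast
  show "(\<exists>n\<ge>4. is_cycle_of_length C n) \<or> is_path C \<or> is_isolated_vertex C"
  proof (rule component_cases[of "adj G" v])
    show "max_degree_2 (adj G)"
      using thin unfolding triangle_free_degree_2_def by blast
    show False if "adj G x y" "adj G y z" "adj G z x" for x y z
      using thin that unfolding triangle_free_degree_2_def by blast
    show "adj G y x" if "adj G x y" for x y using adj_sym[OF that] .
    show "\<not> adj G x x" for x using adj_irrefl[OF G] .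
  next
    fix d :: "'a \<Rightarrow> nat"
    assume d: "inj_on d ?S"
      "\<And>x y. x \<in> ?S \<Longrightarrow> y \<in> ?S \<Longrightarrow> adj G x y \<longleftrightarrow> d x = Suc (d y) \<or> d y = Suc (d x)"
      "\<And>x k. x \<in> ?S \<Longrightarrow> k \<le> d x \<Longrightarrow> k \<in> d ` ?S"
    have "d ` ?S = UNIV \<or> (\<exists>n. d ` ?S = {..<n})"
      by (rule downward_closed_nat_set) (use d(3) in auto)
    then consider "d ` ?S = UNIV" | n where "d ` ?S = {..<n}" by blast
    then have "is_path (induced G ?S)"
    proof cases
      case 1
      have "isomorphic (induced G ?S) one_way_infinite_path"
      proof (rule iso[of _ d])
        show "bij_betw d ?S (verts one_way_infinite_path)"
          using d(1) 1 by (simp add: bij_betw_def one_way_infinite_path_def)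
      qed (simp_all add: adj_one_way_infinite_path d(2))
      then show ?thesis by (simp add: is_path_def)
    next
      case 2
      \<comment> \<open>The vertex \<open>v\<close> itself guarantees \<open>n\<close> \<ge> 1; a
        component with a single vertex appears as the path with \<open>n = 1\<close>.\<close>
      have "d v < n" using 2 reach_refl[of v "adj G"] by blast
      have lt: "d x < n" if "x \<in> ?S" for x using that 2 by blast
      have "isomorphic (induced G ?S) (path_graph n)"
      proof (rule iso[of _ d])
        show "bij_betw d ?S (verts (path_graph n))"
          using d(1) 2 by (simp add: bij_betw_def path_graph_def)
      qed (simp_all add: adj_path_graph d(2) lt)
      then show ?thesis using \<open>d v < n\<close> unfolding is_path_def
        by (intro disjI1 exI[of _ n]) simp
    qed
    then show ?thesis by (simp add: C)
  next
    fix d :: "'a \<Rightarrow> int"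
    assume d: "bij_betw d ?S UNIV"
      "\<And>x y. x \<in> ?S \<Longrightarrow> y \<in> ?S \<Longrightarrow> adj G x y \<longleftrightarrow> d x = d y + 1 \<or> d y = d x + 1"
    have "isomorphic (induced G ?S) two_way_infinite_path"
    proof (rule iso[of _ d])
      show "bij_betw d ?S (verts two_way_infinite_path)"
        using d(1) by (simp add: two_way_infinite_path_def)
    qed (simp_all add: adj_two_way_infinite_path d(2))
    then show ?thesis by (simp add: C is_path_def)
  next
    fix d :: "'a \<Rightarrow> nat" and n
    assume n: "4 \<le> n" and d: "bij_betw d ?S {..<n}"
      "\<And>x y. x \<in> ?S \<Longrightarrow> y \<in> ?S \<Longrightarrow> adj G x y \<longleftrightarrow> d x = Suc (d y) mod n \<or> d y = Suc (d x) mod n"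
    have lt: "d x < n" if "x \<in> ?S" for x using d(1) that by (auto simp: bij_betw_def)
    have "isomorphic (induced G ?S) (cycle_graph n)"
    proof (rule iso[of _ d])
      show "\<not> adj (cycle_graph n) i i" for i
        using n by (auto simp: adj_cycle_graph mod_Suc)
      show "bij_betw d ?S (verts (cycle_graph n))" using d(1) by (simp add: cycle_graph_def)
    qed (simp_all add: adj_cycle_graph d(2) lt)
    then show ?thesis using n unfolding C is_cycle_of_length_def
      by (intro disjI1 exI[of _ n]) simp
  qed
qed

section \<open>Paths and long cycles: degrees and triangles\<close>

lemma triangle_free_degree_2_path_graph: "triangle_free_degree_2 (path_graph n)"
  by (auto simp: triangle_free_degree_2_def max_degree_2_def adj_path_graph)

lemma triangle_free_degree_2_one_way_infinite_path: "triangle_free_degree_2 one_way_infinite_path"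
  by (auto simp: triangle_free_degree_2_def max_degree_2_def adj_one_way_infinite_path)

lemma triangle_free_degree_2_two_way_infinite_path: "triangle_free_degree_2 two_way_infinite_path"
  by (auto simp: triangle_free_degree_2_def max_degree_2_def adj_two_way_infinite_path)

lemma triangle_free_degree_2_cycle_graph:
  assumes "n \<ge> 4"
  shows "triangle_free_degree_2 (cycle_graph n)"
  unfolding triangle_free_degree_2_def max_degree_2_def
proof (intro conjI allI impI notI)
  \<comment> \<open>Only the step from \<open>n - 1\<close> wraps around, so adjacency can be
    written without \<open>mod\<close> and the claims become linear arithmetic.\<close>
  have suc: "Suc k mod n = (if Suc k = n then 0 else Suc k)" if "k < n" for k
    using that by (simp add: mod_Suc)
  have adj: "adj (cycle_graph n) i j \<longleftrightarrow> i < n \<and> j < n \<and>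
      (i = Suc j \<or> j = Suc i \<or> i = 0 \<and> Suc j = n \<or> j = 0 \<and> Suc i = n)" for i j
  proof (cases "i < n \<and> j < n")
    case True
    then show ?thesis unfolding adj_cycle_graph using suc[of i] suc[of j] by (simp; linarith)
  qed (auto simp: adj_cycle_graph)
  show "a = b \<or> a = c \<or> b = c"
    if "adj (cycle_graph n) x a" "adj (cycle_graph n) x b" "adj (cycle_graph n) x c" for x a b c
    using that assms unfolding adj by auto
  show False
    if "adj (cycle_graph n) x y" "adj (cycle_graph n) y z" "adj (cycle_graph n) z x" for x y z
    using that assms unfolding adj by auto
qed

lemma isomorphic_triangle_free_degree_2:
  assumes C: "isomorphic C H" and H: "triangle_free_degree_2 H"
    and verts: "\<And>x y. adj C x y \<Longrightarrow> x \<in> verts C \<and> y \<in> verts C"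
  shows "triangle_free_degree_2 C"
proof -
  from C obtain f where f: "inj_on f (verts C)"
    and a: "\<And>x y. x \<in> verts C \<Longrightarrow> y \<in> verts C \<Longrightarrow> adj C x y \<longleftrightarrow> adj H (f x) (f y)"
    unfolding isomorphic_def adj_def[symmetric] bij_betw_def by (elim exE conjE) simp
  have adj: "adj H (f x) (f y)" if "adj C x y" for x y using a verts[OF that] that by blast
  have eq: "x = y" if "f x = f y" "x \<in> verts C" "y \<in> verts C" for x y
    using that f by (auto dest: inj_onD)
  show ?thesis
    unfolding triangle_free_degree_2_def max_degree_2_def
  proof (intro conjI allI impI notI)
    show "p = q \<or> p = r \<or> q = r" if "adj C x p" "adj C x q" "adj C x r" for x p q r
    proof -
      have "f p = f q \<or> f p = f r \<or> f q = f r"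
        using H adj[OF that(1)] adj[OF that(2)] adj[OF that(3)]
        unfolding triangle_free_degree_2_def max_degree_2_def by blast
      then show ?thesis
        using eq verts[OF that(1)] verts[OF that(2)] verts[OF that(3)] by blast
    qed
    show False if "adj C x y" "adj C y z" "adj C z x" for x y z
      using H adj[OF that(1)] adj[OF that(2)] adj[OF that(3)]
      unfolding triangle_free_degree_2_def by blast
  qed
qed

text \<open>Triangles and neighbourhoods stay within one component, so the local condition can be
  checked component by component; the other direction is the numbering of components.\<close>

lemma triangle_free_degree_2_iff:
  assumes G: "is_graph G"
  shows "components_cycles_or_paths G \<longleftrightarrow> triangle_free_degree_2 G"
proof
  assume comp: "components_cycles_or_paths G"
  have thin: "triangle_free_degree_2 (induced G (reach (adj G) v))" if "v \<in> verts G" for v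
  proof -
    let ?C = "induced G (reach (adj G) v)"
    have "?C \<in> components G" using that by (auto simp: components_eq[OF G])
    then consider n where "n \<ge> 4" "is_cycle_of_length ?C n" | "is_path ?C" | "is_isolated_vertex ?C"
      using comp unfolding components_cycles_or_paths_def by blast
    then show ?thesis
    proof cases
      case 3
      then have "\<not> adj ?C x y" for x y by (auto simp: is_isolated_vertex_def adj_def)
      then show ?thesis by (simp add: triangle_free_degree_2_def max_degree_2_def)
    next
      case 1
      then show ?thesis
        using isomorphic_triangle_free_degree_2[of ?C "cycle_graph n"]
          triangle_free_degree_2_cycle_graph[of n]
        by (simp add: is_cycle_of_length_def adj_induced) (simp add: induced_def)
    next
      case 2
      have "x \<in> verts ?C \<and> y \<in> verts ?C" if "adj ?C x y" for x y
        using that unfolding adj_induced by (simp add: induced_def)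
      then show ?thesis
        using 2 isomorphic_triangle_free_degree_2[of ?C, OF _ triangle_free_degree_2_path_graph]
          isomorphic_triangle_free_degree_2[of ?C, OF _ triangle_free_degree_2_one_way_infinite_path]
          isomorphic_triangle_free_degree_2[of ?C, OF _ triangle_free_degree_2_two_way_infinite_path]
        unfolding is_path_def by blast
    qed
  qed
  have adj: "adj (induced G (reach (adj G) v)) x y"
    if "adj G x y" "x \<in> reach (adj G) v" for v x y
    using that adj_verts[OF G that(1)] reach_step[of x "adj G" v y] by (simp add: adj_induced)
  show "triangle_free_degree_2 G"
    unfolding triangle_free_degree_2_def max_degree_2_def
  proof (intro conjI allI impI notI)
    fix x a b c
    assume *: "adj G x a" "adj G x b" "adj G x c"
    then have "triangle_free_degree_2 (induced G (reach (adj G) x))"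
      using thin adj_verts[OF G] by blast
    then show "a = b \<or> a = c \<or> b = c"
      using * [THEN adj, OF reach_refl]
      unfolding triangle_free_degree_2_def max_degree_2_def by blast
  next
    fix x y z
    assume *: "adj G x y" "adj G y z" "adj G z x"
    then have "triangle_free_degree_2 (induced G (reach (adj G) x))"
      using thin adj_verts[OF G] by blast
    moreover have y: "y \<in> reach (adj G) x" using reach_step[of x "adj G" x y, OF reach_refl *(1)] .
    moreover have "z \<in> reach (adj G) x" using reach_step[of y "adj G" x z, OF y *(2)] .
    ultimately show False
      using adj[OF *(1) reach_refl] adj[OF *(2), of x] adj[OF *(3), of x]
      unfolding triangle_free_degree_2_def by blast
  qed
qed (rule components_of_triangle_free_degree_2[OF G])

section \<open>The classification\<close>

lemma is_graph_P9: "is_graph P9"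
  by (auto simp: is_graph_def P9_def)

lemma co_eq_adj_complement:
  assumes "claw_coclaw_free (verts G) (adj G)"
  shows "claw_coclaw_free.co (verts G) (adj G) = adj (complement G)"
proof -
  interpret claw_coclaw_free "verts G" "adj G" by fact
  show ?thesis by (intro ext) (simp add: co_def adj_complement)
qed

lemma claw_coclaw_free_complement:
  assumes "claw_coclaw_free (verts G) (adj G)"
  shows "claw_coclaw_free (verts (complement G)) (adj (complement G))"
  using claw_coclaw_free.dual[OF assms] by (simp add: co_eq_adj_complement[OF assms])

text \<open>A claw needs a vertex with three distinct neighbours, and its complement contains a
  triangle.\<close>

lemma claw_coclaw_free_of_triangle_free:
  assumes G: "is_graph G" and thin: "triangle_free_degree_2 G"
  shows "claw_coclaw_free (verts G) (adj G)"
proof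
  show "adj G y x" if "adj G x y" for x y using adj_sym[OF that] .
  show "\<not> adj G x x" for x using adj_irrefl[OF G] .
  show "x \<in> verts G" if "adj G x y" for x y using adj_verts[OF G that] ..
  show "adj G a b \<or> adj G a c \<or> adj G b c"
    if "adj G x a" "adj G x b" "adj G x c" "a \<noteq> b" "a \<noteq> c" "b \<noteq> c" for x a b c
    using thin that unfolding triangle_free_degree_2_def max_degree_2_def by blast
  show "adj G x a \<or> adj G x b \<or> adj G x c"
    if "adj G a b" "adj G a c" "adj G b c" for a b c x
    using thin that(1,3) adj_sym[OF that(2)] unfolding triangle_free_degree_2_def by blast
qed

lemma in_list_claw_coclaw_free:
  assumes G: "is_graph G" and list: "in_list G"
  shows "claw_coclaw_free (verts G) (adj G)"
proof -
  consider "isomorphic G A6" | "isomorphic_to_induced G P9" | "components_cycles_or_paths G"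
    using list unfolding in_list_def by blast
  then show ?thesis
  proof cases
    case 1
    then obtain f where f: "bij_betw f (verts G) (verts A6)"
      and a: "\<forall>x\<in>verts G. \<forall>y\<in>verts G. adj G x y \<longleftrightarrow> adj A6 (f x) (f y)"
      unfolding isomorphic_def adj_def[symmetric] by blast
    show ?thesis
    proof (rule claw_coclaw_free_transfer[OF claw_coclaw_free_A6])
      show "inj_on f (verts G)" "f ` verts G \<subseteq> verts A6"
        using f by (auto simp: bij_betw_def)
      show "adj G x y \<longleftrightarrow> adj A6 (f x) (f y)" if "x \<in> verts G" "y \<in> verts G" for x y
        using a that by simp
      show "x \<in> verts G \<and> y \<in> verts G" if "adj G x y" for x y
        using adj_verts[OF G that] by simp
    qed
  next
    case 2
    then obtain f where f: "inj_on f (verts G)" "f ` verts G \<subseteq> verts P9"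
      and a: "\<forall>x\<in>verts G. \<forall>y\<in>verts G. adj G x y \<longleftrightarrow> adj P9 (f x) (f y)"
      unfolding isomorphic_to_induced_iff[OF is_graph_P9 G] by blast
    show ?thesis
    proof (rule claw_coclaw_free_transfer[OF claw_coclaw_free_P9 f])
      show "adj G x y \<longleftrightarrow> adj P9 (f x) (f y)" if "x \<in> verts G" "y \<in> verts G" for x y
        using a that by simp
      show "x \<in> verts G \<and> y \<in> verts G" if "adj G x y" for x y
        using adj_verts[OF G that] by simp
    qed
  next
    case 3
    then show ?thesis
      using claw_coclaw_free_of_triangle_free[OF G] triangle_free_degree_2_iff[OF G] by blast
  qed
qed

lemma in_list_of_triangle_free:
  assumes G: "is_graph G" and free: "claw_coclaw_free (verts G) (adj G)"
    and tri: "\<And>x y z. adj G x y \<Longrightarrow> adj G x z \<Longrightarrow> \<not> adj G y z"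
  shows "in_list G"
proof -
  interpret claw_coclaw_free "verts G" "adj G" by fact
  have "max_degree_2 (adj G)"
    unfolding max_degree_2_def
  proof (intro allI impI)
    fix x a b c assume "adj G x a" "adj G x b" "adj G x c"
    then show "a = b \<or> a = c \<or> b = c"
      using claw[of x a b c] tri[of x a b] tri[of x a c] tri[of x b c] by metis
  qed
  moreover have "\<not> adj G z x" if "adj G x y" "adj G y z" for x y z
    using tri[of y x z] adj_sym[OF that(1)] that(2) adj_sym[of G z x] by blast
  ultimately have "triangle_free_degree_2 G" unfolding triangle_free_degree_2_def by blast
  then show ?thesis using triangle_free_degree_2_iff[OF G] by (simp add: in_list_def)
qed

theorem theorem1p1:
  fixes G :: "'a graph"
  assumes "is_graph G"
  shows "G \<in> Forb {K13, complement K13} \<longleftrightarrow> in_list G \<or> in_list (complement G)"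
proof
  note G = assms
  assume "G \<in> Forb {K13, complement K13}"
  then have free: "claw_coclaw_free (verts G) (adj G)" using Forb_claw_iff[OF G] by blast
  then interpret claw_coclaw_free "verts G" "adj G" .
  have co: "co = adj (complement G)" using co_eq_adj_complement[OF free] .
  show "in_list G \<or> in_list (complement G)"
  proof (cases "\<exists>a b c. adj G a b \<and> adj G a c \<and> adj G b c")
    case False
    then show ?thesis using in_list_of_triangle_free[OF G free] by blast
  next
    case tri: True
    show ?thesis
    proof (cases "\<exists>p q r. co p q \<and> co p r \<and> co q r")
      case False
      then show ?thesis
        using in_list_of_triangle_free[OF is_graph_complement claw_coclaw_free_complement[OF free]]
        unfolding co by blast
    next
      case True
      with tri obtain x t1 t2 s1 s2 where "bull (verts G) (adj G) x t1 t2 s1 s2"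
        using bull_exists by metis
      then interpret bull "verts G" "adj G" x t1 t2 s1 s2 .
      consider "isomorphic G A6" | "isomorphic (complement G) A6" | "isomorphic_to_induced G P9"
        using A6_or_P9
        unfolding isomorphic_to_induced_iff[OF is_graph_P9 G] isomorphic_def verts_complement
          co adj_def by blast
      then show ?thesis unfolding in_list_def by cases simp_all
    qed
  qed
next
  assume "in_list G \<or> in_list (complement G)"
  then have "claw_coclaw_free (verts G) (adj G)"
  proof
    assume "in_list (complement G)"
    then have "claw_coclaw_free (verts (complement G)) (adj (complement G))"
      using in_list_claw_coclaw_free[OF is_graph_complement] by blast
    \<comment> \<open>The axioms are invariant under complementation, and complementing twice
      restores \<open>G\<close>.\<close>
    from claw_coclaw_free_complement[OF this] show ?thesis
      by (simp add: complement_complement[OF assms])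
  qed (rule in_list_claw_coclaw_free[OF assms])
  then show "G \<in> Forb {K13, complement K13}" using Forb_claw_iff[OF assms] by blast
qed

end
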